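(* Let $S$ be the one-sided full $2$-shift on $\Sigma_+=\{0,1\}^{\mathbb{N}}$ with the uniform Bernoulli measure $\mu_+$, let $V_S$ be its Perron-Frobenius operator on $L^2(\Sigma_+,\mu_+)$, and let $X=\mathbb{C}[h]$, $\Phi_k$, $\Phi_k'$, $U_S^\times$ be as defined in the context. Then: (1) The resolvent $(\lambda-V_S)^{-1}$ has an analytic continuation to the inside of the unit circle as an operator from $X$ into $X'$. The generalized eigenvalues with respect to the Gelfand triplet $X\subset L^2(\Sigma_+,\mu_+)\subset X'$ are $2^{-k}$, $k=0,1,2,\dots$, and the associated generalized eigenvectors are $\Phi_k$, $k=0,1,2,\dots$. (2) $V_S$ and $U_S^\times$ have spectral decompositions of the form $$V_Sf=\sum_{i=0}^\infty 2^{-i}\,\overline{\langle\Phi_i'\,|\,f\rangle}\,\Phi_i,\quad f\in X,$$ $$U_S^\times\mu=\sum_{i=0}^\infty 2^{-i}\,\langle\mu\,|\,\Phi_i\rangle\,\Phi_i',\quad \mu\in X'.$$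
   Context: Setting: $\Sigma_+=\{0,1\}^{\mathbb{N}}$ has elements $\omega=(\omega_1,\omega_2,\dots)$ and the product topology; $(S\omega)_j=\omega_{j+1}$; $\mu_+=\mu_0^{\otimes\mathbb{N}}$ with $\mu_0(\{0\})=\mu_0(\{1\})=1/2$. The Koopman operator on $L^2(\Sigma_+,\mu_+)$ is $(U_Sf)(\omega)=f(S\omega)$ (an isometry), and the Perron-Frobenius operator is its adjoint $V_S=U_S^*$. Inner products $(\cdot,\cdot)$ are linear in the first variable. Test space: $h:\Sigma_+\to[0,1]$, $h(\omega)=\sum_{i\ge1}\omega_i2^{-i}$. $X_n=\sum_{i=0}^n\mathbb{C}h^i\subset L^2(\Sigma_+,\mu_+)$ (dimension $n+1$, usual topology), and $X=\varinjlim X_n=\mathbb{C}[h]$ with the inductive limit topology. It is dense in $L^2(\Sigma_+,\mu_+)$ with a stronger topology, and $V_S$ maps $X_n$ to $X_n$ and is continuous on $X$. Duality: $X'$ is the space of continuous anti-linear functionals on $X$ with the weak* topology; $\mu(f)$ is written $\langle\mu|f\rangle$ (linear in $\mu$, anti-linear in $f$). $L^2(\Sigma_+,\mu_+)\subset X'$ via $g\mapsto(g,\cdot)$; $X\subset L^2(\Sigma_+,\mu_+)\subset X'$ is the Gelfand triplet. Infinite series in $X'$ converge in the weak* topology. $\Phi_n\in X_n$ is the unique eigenvector of $V_S|_X$ with eigenvalue $2^{-n}$ that is a monic polynomial in $h$ of degree $n$; these form a basis of $X$. $\{\Phi_n'\}\subset X'$ is the dual basis, $\langle\Phi_i'|\Phi_j\rangle=\delta_{i,j}$.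 The dual operator $U_S^\times:X'\to X'$ is defined by $\langle U_S^\times\mu|f\rangle=\langle\mu|U_S^*f\rangle=\langle\mu|V_Sf\rangle$ for $f\in X$, $\mu\in X'$. Generalized spectrum: for $f\in X$ the map $\lambda\mapsto(\lambda-V_S)^{-1}f\in L^2(\Sigma_+,\mu_+)\subset X'$ is holomorphic for $|\lambda|>1$. The resolvent has an analytic continuation as an operator from $X$ into $X'$ if, for every $f\in X$, this $X'$-valued function continues analytically (weak* sense) from $|\lambda|>1$ across the unit circle to its inside, outside a set of singularities; the continuation $R_\lambda:X\to X'$ is the generalized resolvent, and the set of its singularities is the generalized spectrum. For an isolated singularity $\lambda_0$, the Riesz projection is $\Pi_{\lambda_0}f=\frac1{2\pi i}\oint_C R_zf\,dz$ ($C$ a positively oriented closed curve encircling $\lambda_0$ and no other singularity), an operator from $X$ into $X'$. Such a $\lambda_0$ is a generalized eigenvalue if it has associated eigenvectors in $X'$; the generalized eigenspace is the image of $\Pi_{\lambda_0}$ and its nonzero elements are the generalized eigenvectors. *)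

theory Defs
  imports "HOL-Probability.Probability" "HOL-Complex_Analysis.Complex_Analysis"
begin

section \<open>The one-sided full 2-shift\<close>

text \<open>A point of \<open>\<Sigma>\<^sub>+\<close> is a function \<open>nat \<Rightarrow> bool\<close>, with \<open>True\<close> for the symbol 1 and \<open>False\<close> for 0;
  the coordinate \<open>\<omega>\<^sub>i\<close> (\<open>i \<ge> 1\<close>) is \<open>\<omega> (i - 1)\<close>.\<close>

type_synonym sigma_plus = "nat \<Rightarrow> bool"

definition mu_plus :: "sigma_plus measure" where
  "mu_plus = (\<Pi>\<^sub>M i\<in>UNIV. uniform_count_measure (UNIV :: bool set))"

definition shift_map :: "sigma_plus \<Rightarrow> sigma_plus" where
  "shift_map \<omega> = (\<lambda>i. \<omega> (Suc i))"

definition h_map :: "sigma_plus \<Rightarrow> real" where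
  "h_map \<omega> = (\<Sum>i. of_bool (\<omega> i) * (1/2) ^ Suc i)"

lemma prob_space_coin: "prob_space (uniform_count_measure (UNIV :: bool set))"
  by (rule prob_space_uniform_count_measure) auto

lemma prob_space_mu_plus: "prob_space mu_plus"
  unfolding mu_plus_def by (rule prob_space_PiM) (rule prob_space_coin)

interpretation mu_plus: prob_space mu_plus
  by (rule prob_space_mu_plus)

lemma space_mu_plus [simp]: "space mu_plus = UNIV"
  by (simp add: mu_plus_def space_PiM space_uniform_count_measure PiE_UNIV_domain)

lemma measurable_coordinate [measurable]: "(\<lambda>\<omega>. \<omega> i) \<in> measurable mu_plus (count_space UNIV)"
proof -
  have "(\<lambda>\<omega>. \<omega> i) \<in> measurable mu_plus (uniform_count_measure (UNIV :: bool set))"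
    unfolding mu_plus_def by (rule measurable_component_singleton) simp
  moreover have "sets (uniform_count_measure (UNIV :: bool set)) = sets (count_space UNIV)"
    by (simp add: sets_uniform_count_measure)
  ultimately show ?thesis
    using measurable_cong_sets by blast
qed

lemma measurable_shift [measurable]: "shift_map \<in> measurable mu_plus mu_plus"
proof -
  have "(\<lambda>\<omega>. \<omega> (Suc i)) \<in> measurable mu_plus (uniform_count_measure (UNIV :: bool set))" for i
    unfolding mu_plus_def by (rule measurable_component_singleton) simp
  then have "(\<lambda>\<omega>. \<lambda>i. \<omega> (Suc i)) \<in> measurable mu_plus
      (\<Pi>\<^sub>M i\<in>UNIV. uniform_count_measure (UNIV :: bool set))"
    by (intro measurable_PiM_single') (auto simp: space_uniform_count_measure)
  then show ?thesis
    by (simp add: shift_map_def[abs_def] mu_plus_def)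
qed

lemma distr_shift: "distr mu_plus mu_plus shift_map = mu_plus"
proof -
  have "distr (\<Pi>\<^sub>M i\<in>UNIV. uniform_count_measure (UNIV :: bool set))
      (\<Pi>\<^sub>M i\<in>UNIV. uniform_count_measure (UNIV :: bool set)) (\<lambda>\<omega>. \<lambda>n\<in>UNIV. \<omega> (Suc n))
      = (\<Pi>\<^sub>M i\<in>UNIV. uniform_count_measure (UNIV :: bool set))"
    by (rule distr_PiM_reindex) (auto intro: prob_space_coin)
  then show ?thesis
    by (simp add: mu_plus_def shift_map_def[abs_def] restrict_UNIV)
qed

lemma measurable_h [measurable]: "h_map \<in> borel_measurable mu_plus"
  unfolding h_map_def[abs_def] by measurable

lemma summable_h: "summable (\<lambda>i. of_bool (\<omega> i) * (1/2 :: real) ^ Suc i)"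
  by (rule summable_comparison_test'[where N=0 and g="\<lambda>i. (1/2 :: real) ^ Suc i"])
     (auto simp: summable_geometric)

lemma h_ge_0: "0 \<le> h_map \<omega>"
  unfolding h_map_def by (rule suminf_nonneg[OF summable_h]) auto

lemma h_le_1: "h_map \<omega> \<le> 1"
proof -
  have "h_map \<omega> \<le> (\<Sum>i. (1/2 :: real) ^ Suc i)"
    unfolding h_map_def by (rule suminf_le[OF _ summable_h]) (auto simp: summable_geometric)
  also have "\<dots> = 1"
    using power_half_series by (rule sums_unique[symmetric])
  finally show ?thesis .
qed


section \<open>The Hilbert space\<close>

definition square_integrable :: "(sigma_plus \<Rightarrow> complex) \<Rightarrow> bool" where
  "square_integrable f \<longleftrightarrow>
     f \<in> borel_measurable mu_plus \<and> integrable mu_plus (\<lambda>\<omega>. (cmod (f \<omega>))\<^sup>2)"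

lemma square_integrable_measurable [measurable_dest]:
  "square_integrable f \<Longrightarrow> f \<in> borel_measurable mu_plus"
  by (simp add: square_integrable_def)

lemma square_integrable_bounded:
  assumes [measurable]: "f \<in> borel_measurable mu_plus" and "\<And>\<omega>. cmod (f \<omega>) \<le> B"
  shows "square_integrable f"
  unfolding square_integrable_def
proof (intro conjI mu_plus.integrable_const_bound[where B="B\<^sup>2"] AE_I2)
  show "norm ((cmod (f \<omega>))\<^sup>2) \<le> B\<^sup>2" for \<omega>
    using assms(2)[of \<omega>] by (auto intro: power_mono)
qed measurable

lemma square_integrable_add:
  assumes "square_integrable f" "square_integrable g"
  shows "square_integrable (\<lambda>\<omega>. f \<omega> + g \<omega>)"
proof -
  note [measurable] = assms[THEN square_integrable_measurable]
  have bound: "(cmod (a + b))\<^sup>2 \<le> 2 * (cmod a)\<^sup>2 + 2 * (cmod b)\<^sup>2" for a b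
  proof -
    have "(cmod (a + b))\<^sup>2 \<le> (cmod a + cmod b)\<^sup>2"
      by (intro power_mono norm_triangle_ineq) auto
    also have "\<dots> \<le> 2 * (cmod a)\<^sup>2 + 2 * (cmod b)\<^sup>2"
      using sum_squares_bound[of "cmod a" "cmod b"] by (simp add: power2_sum)
    finally show ?thesis .
  qed
  have "integrable mu_plus (\<lambda>\<omega>. 2 * (cmod (f \<omega>))\<^sup>2 + 2 * (cmod (g \<omega>))\<^sup>2)"
    using assms by (auto simp: square_integrable_def)
  then have "integrable mu_plus (\<lambda>\<omega>. (cmod (f \<omega> + g \<omega>))\<^sup>2)"
    by (rule Bochner_Integration.integrable_bound) (use bound in auto)
  then show ?thesis
    by (simp add: square_integrable_def)
qed

lemma square_integrable_scale:
  "square_integrable f \<Longrightarrow> square_integrable (\<lambda>\<omega>. c * f \<omega>)"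
  by (auto simp: square_integrable_def norm_mult power_mult_distrib)

lemma square_integrable_shift:
  assumes "square_integrable f"
  shows "square_integrable (\<lambda>\<omega>. f (shift_map \<omega>))"
proof -
  note [measurable] = assms[THEN square_integrable_measurable]
  have "integrable (distr mu_plus mu_plus shift_map) (\<lambda>\<omega>. (cmod (f \<omega>))\<^sup>2)"
    using assms by (simp add: distr_shift square_integrable_def)
  then have "integrable mu_plus (\<lambda>\<omega>. (cmod (f (shift_map \<omega>)))\<^sup>2)"
    by (subst (asm) integrable_distr_eq) auto
  then show ?thesis
    by (simp add: square_integrable_def)
qed

lemma AE_shift:
  assumes "AE \<omega> in mu_plus. P \<omega>"
  shows "AE \<omega> in mu_plus. P (shift_map \<omega>)"
proof -
  obtain N where N: "{\<omega> \<in> space mu_plus. \<not> P \<omega>} \<subseteq> N" "emeasure mu_plus N = 0" "N \<in> sets mu_plus"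
    using assms by (rule AE_E)
  have "emeasure (distr mu_plus mu_plus shift_map) N = 0"
    using N by (simp add: distr_shift)
  then have "emeasure mu_plus (shift_map -` N \<inter> space mu_plus) = 0"
    using N by (simp add: emeasure_distr)
  moreover have "shift_map -` N \<inter> space mu_plus \<in> sets mu_plus"
    using N by measurable
  ultimately show ?thesis
    using N(1) by (intro AE_I[where N="shift_map -` N \<inter> space mu_plus"]) auto
qed

lemma borel_measurable_cnj [measurable]: "cnj \<in> borel_measurable borel"
  by (intro borel_measurable_continuous_onI continuous_intros)

lemma integrable_mult_cnj:
  assumes "square_integrable f" "square_integrable g"
  shows "integrable mu_plus (\<lambda>\<omega>. f \<omega> * cnj (g \<omega>))"
proof -
  note [measurable] = assms[THEN square_integrable_measurable]
  have "integrable mu_plus (\<lambda>\<omega>. (cmod (f \<omega>))\<^sup>2 + (cmod (g \<omega>))\<^sup>2)"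
    using assms by (auto simp: square_integrable_def)
  then show ?thesis
  proof (rule Bochner_Integration.integrable_bound)
    show "AE \<omega> in mu_plus. norm (f \<omega> * cnj (g \<omega>)) \<le> norm ((cmod (f \<omega>))\<^sup>2 + (cmod (g \<omega>))\<^sup>2)"
    proof (rule AE_I2)
      fix \<omega>
      have "2 * (cmod (f \<omega>) * cmod (g \<omega>)) \<le> (cmod (f \<omega>))\<^sup>2 + (cmod (g \<omega>))\<^sup>2"
        using sum_squares_bound[of "cmod (f \<omega>)" "cmod (g \<omega>)"] by simp
      moreover have "0 \<le> cmod (f \<omega>) * cmod (g \<omega>)"
        by simp
      ultimately show "norm (f \<omega> * cnj (g \<omega>)) \<le> norm ((cmod (f \<omega>))\<^sup>2 + (cmod (g \<omega>))\<^sup>2)"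
        unfolding norm_mult complex_mod_cnj real_norm_def by linarith
    qed
  qed measurable
qed

quotient_type l2 = "sigma_plus \<Rightarrow> complex" / partial:
  "\<lambda>f g. square_integrable f \<and> square_integrable g \<and> (AE \<omega> in mu_plus. f \<omega> = g \<omega>)"
proof (rule part_equivpI)
  show "\<exists>f. square_integrable f \<and> square_integrable f \<and> (AE \<omega> in mu_plus. f \<omega> = f \<omega>)"
    by (rule exI[where x="\<lambda>_. 0"]) (simp add: square_integrable_def)
qed (auto intro!: sympI transpI elim: AE_mp)

lift_definition cinner :: "l2 \<Rightarrow> l2 \<Rightarrow> complex" is
  "\<lambda>f g. \<integral>\<omega>. f \<omega> * cnj (g \<omega>) \<partial>mu_plus"
proof (elim conjE)
  fix f f' g g' :: "sigma_plus \<Rightarrow> complex"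
  assume sq: "square_integrable f" "square_integrable f'" "square_integrable g" "square_integrable g'"
    and ae: "AE \<omega> in mu_plus. f \<omega> = f' \<omega>" "AE \<omega> in mu_plus. g \<omega> = g' \<omega>"
  note [measurable] = sq[THEN square_integrable_measurable]
  show "(\<integral>\<omega>. f \<omega> * cnj (g \<omega>) \<partial>mu_plus) = (\<integral>\<omega>. f' \<omega> * cnj (g' \<omega>) \<partial>mu_plus)"
    by (rule integral_cong_AE) (use ae in \<open>measurable, auto\<close>)
qed

lift_definition cscale :: "complex \<Rightarrow> l2 \<Rightarrow> l2" is "\<lambda>c f \<omega>. c * f \<omega>"
  by (auto intro: square_integrable_scale)

instantiation l2 :: ab_group_add
begin

lift_definition zero_l2 :: l2 is "\<lambda>_. 0"
  by (simp add: square_integrable_def)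

lift_definition plus_l2 :: "l2 \<Rightarrow> l2 \<Rightarrow> l2" is "\<lambda>f g \<omega>. f \<omega> + g \<omega>"
  by (auto intro: square_integrable_add)

definition uminus_l2 :: "l2 \<Rightarrow> l2" where "uminus_l2 f = cscale (-1) f"

definition minus_l2 :: "l2 \<Rightarrow> l2 \<Rightarrow> l2" where "minus_l2 f g = f + - g"

instance
proof
  fix f g k :: l2
  show "f + g + k = f + (g + k)"
    by transfer (simp add: add.assoc square_integrable_add)
  show "f + g = g + f"
    by transfer (simp add: add.commute square_integrable_add)
  show "0 + f = f"
    by transfer simp
  show "- f + f = 0"
    unfolding uminus_l2_def by transfer (simp add: square_integrable_def)
  show "f - g = f + - g"
    by (rule minus_l2_def)
qed

end

lemma vector_space_cscale: "vector_space cscale"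
proof
  fix a b :: complex and f g :: l2
  show "cscale a (f + g) = cscale a f + cscale a g"
    by transfer (simp add: distrib_left square_integrable_add square_integrable_scale)
  show "cscale (a + b) f = cscale a f + cscale b f"
    by transfer (simp add: distrib_right square_integrable_add square_integrable_scale)
  show "cscale a (cscale b f) = cscale (a * b) f"
    by transfer (simp add: mult.assoc square_integrable_scale)
  show "cscale 1 f = f"
    by transfer simp
qed

lemma cinner_add_left: "cinner (f + g) k = cinner f k + cinner g k"
  by transfer (simp add: distrib_right integrable_mult_cnj)

lemma cinner_cscale_left: "cinner (cscale c f) g = c * cinner f g"
  by transfer (simp add: mult.assoc)

lemma cinner_commute: "cinner f g = cnj (cinner g f)"
proof transfer
  fix f g :: "sigma_plus \<Rightarrow> complex"
  show "(\<integral>\<omega>. f \<omega> * cnj (g \<omega>) \<partial>mu_plus) = cnj (\<integral>\<omega>. g \<omega> * cnj (f \<omega>) \<partial>mu_plus)"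
    by (subst Bochner_Integration.integral_cnj[symmetric]) (simp add: mult.commute)
qed

lemma Re_cinner_self:
  assumes "square_integrable f"
  shows "Re (\<integral>\<omega>. f \<omega> * cnj (f \<omega>) \<partial>mu_plus) = (\<integral>\<omega>. (cmod (f \<omega>))\<^sup>2 \<partial>mu_plus)"
proof -
  have "(\<lambda>\<omega>. f \<omega> * cnj (f \<omega>)) = (\<lambda>\<omega>. complex_of_real ((cmod (f \<omega>))\<^sup>2))"
    by (simp only: complex_norm_square)
  then show ?thesis
    by (simp only: integral_complex_of_real Re_complex_of_real)
qed

text \<open>The real structure underlying the complex Hilbert space; its norm is the \<open>L\<^sup>2\<close> norm.\<close>

instantiation l2 :: real_vector
begin

definition scaleR_l2 :: "real \<Rightarrow> l2 \<Rightarrow> l2" where "scaleR_l2 r f = cscale (of_real r) f"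

instance
proof -
  interpret vector_space cscale
    by (rule vector_space_cscale)
  show "OFCLASS(l2, real_vector_class)"
    by intro_classes (simp_all add: scaleR_l2_def scale_right_distrib scale_left_distrib)
qed

end

instantiation l2 :: real_inner
begin

definition inner_l2 :: "l2 \<Rightarrow> l2 \<Rightarrow> real" where "inner_l2 f g = Re (cinner f g)"

definition norm_l2 :: "l2 \<Rightarrow> real" where "norm_l2 f = sqrt (inner f f)"

definition sgn_l2 :: "l2 \<Rightarrow> l2" where "sgn_l2 f = f /\<^sub>R norm f"

definition dist_l2 :: "l2 \<Rightarrow> l2 \<Rightarrow> real" where "dist_l2 f g = norm (f - g)"

definition uniformity_l2 :: "(l2 \<times> l2) filter" where
  "uniformity_l2 = (INF e\<in>{0<..}. principal {(f, g). dist f g < e})"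

definition open_l2 :: "l2 set \<Rightarrow> bool" where
  "open_l2 U \<longleftrightarrow> (\<forall>f\<in>U. eventually (\<lambda>(f', g). f' = f \<longrightarrow> g \<in> U) uniformity)"

instance
proof
  fix f g k :: l2 and a :: real
  show "sgn f = f /\<^sub>R norm f"
    by (rule sgn_l2_def)
  show "dist f g = norm (f - g)"
    by (rule dist_l2_def)
  show "(uniformity :: (l2 \<times> l2) filter) = (INF e\<in>{0<..}. principal {(f, g). dist f g < e})"
    by (rule uniformity_l2_def)
  show "open U \<longleftrightarrow> (\<forall>f\<in>U. eventually (\<lambda>(f', g). f' = f \<longrightarrow> g \<in> U) uniformity)" for U :: "l2 set"
    by (rule open_l2_def)
  show "inner f g = inner g f"
    unfolding inner_l2_def by (subst cinner_commute) simp
  show "inner (f + g) k = inner f k + inner g k"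
    by (simp add: inner_l2_def cinner_add_left)
  show "inner (a *\<^sub>R f) g = a * inner f g"
    by (simp add: inner_l2_def scaleR_l2_def cinner_cscale_left)
  show "0 \<le> inner f f"
    unfolding inner_l2_def by transfer (simp add: Re_cinner_self)
  show "inner f f = 0 \<longleftrightarrow> f = 0"
    unfolding inner_l2_def
  proof transfer
    fix f :: "sigma_plus \<Rightarrow> complex"
    assume "square_integrable f \<and> square_integrable f \<and> (AE \<omega> in mu_plus. f \<omega> = f \<omega>)"
    then have f: "square_integrable f"
      by simp
    then have "(\<integral>\<omega>. (cmod (f \<omega>))\<^sup>2 \<partial>mu_plus) = 0 \<longleftrightarrow> (AE \<omega> in mu_plus. (cmod (f \<omega>))\<^sup>2 = 0)"
      by (intro integral_nonneg_eq_0_iff_AE) (auto simp: square_integrable_def)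
    then show "Re (\<integral>\<omega>. f \<omega> * cnj (f \<omega>) \<partial>mu_plus) = 0 \<longleftrightarrow>
        square_integrable f \<and> square_integrable (\<lambda>_. 0) \<and> (AE \<omega> in mu_plus. f \<omega> = 0)"
      using f by (simp add: Re_cinner_self) (simp add: square_integrable_def)
  qed
  show "norm f = sqrt (inner f f)"
    by (rule norm_l2_def)
qed

end

lift_definition koopman :: "l2 \<Rightarrow> l2" is "\<lambda>f \<omega>. f (shift_map \<omega>)"
  by (elim conjE, intro conjI square_integrable_shift, assumption+) (rule AE_shift)

definition perron_frobenius :: "l2 \<Rightarrow> l2" where
  "perron_frobenius = (THE V. \<forall>f g. cinner (koopman f) g = cinner f (V g))"

text \<open>\<open>(\<lambda> - V\<^sub>S)\<^sup>-\<^sup>1\<close>, a genuine inverse for \<open>|\<lambda>| > 1\<close> and used only there.\<close>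

definition resolvent :: "complex \<Rightarrow> l2 \<Rightarrow> l2" where
  "resolvent l = inv (\<lambda>f. cscale l f - perron_frobenius f)"


section \<open>Test space, dual space, Gelfand triplet\<close>

lift_definition poly_h :: "complex poly \<Rightarrow> l2" is "\<lambda>p \<omega>. poly p (of_real (h_map \<omega>))"
proof -
  fix p :: "complex poly"
  have "compact ((\<lambda>x. poly p (complex_of_real x)) ` {0..1})"
    by (intro compact_continuous_image continuous_intros) auto
  then obtain B where "\<And>x. x \<in> {0..1} \<Longrightarrow> cmod (poly p (of_real x)) \<le> B"
    by (fastforce dest: compact_imp_bounded simp: bounded_iff)
  then have "square_integrable (\<lambda>\<omega>. poly p (of_real (h_map \<omega>)))"
    by (intro square_integrable_bounded[where B=B]) (auto simp: h_ge_0 h_le_1 poly_altdef)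
  then show "square_integrable (\<lambda>\<omega>. poly p (of_real (h_map \<omega>))) \<and>
      square_integrable (\<lambda>\<omega>. poly p (of_real (h_map \<omega>))) \<and>
      (AE \<omega> in mu_plus. poly p (of_real (h_map \<omega>)) = poly p (of_real (h_map \<omega>)))"
    by simp
qed

definition X_sub :: "nat \<Rightarrow> l2 set" where
  "X_sub n = {poly_h p | p. degree p \<le> n}"

definition X_space :: "l2 set" where
  "X_space = (\<Union>n. X_sub n)"

text \<open>The inductive limit topology: the finest one making all inclusions \<open>X\<^sub>n \<rightarrow> X\<close> continuous, where
  \<open>X\<^sub>n\<close> has its norm topology. For an increasing sequence of finite-dimensional spaces this final
  topology is a locally convex vector space topology, so it is also the inductive limit in the
  locally convex category.\<close>

definition X_top :: "l2 topology" where
  "X_top = topology (\<lambda>U. U \<subseteq> X_space \<and> (\<forall>n. openin (top_of_set (X_sub n)) (U \<inter> X_sub n)))"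

lemma openin_X_top:
  "openin X_top U \<longleftrightarrow> U \<subseteq> X_space \<and> (\<forall>n. openin (top_of_set (X_sub n)) (U \<inter> X_sub n))"
proof -
  have "istopology (\<lambda>U. U \<subseteq> X_space \<and> (\<forall>n. openin (top_of_set (X_sub n)) (U \<inter> X_sub n)))"
    unfolding istopology_def
  proof (intro conjI allI impI)
    fix S T n
    assume S: "S \<subseteq> X_space \<and> (\<forall>n. openin (top_of_set (X_sub n)) (S \<inter> X_sub n))"
      and T: "T \<subseteq> X_space \<and> (\<forall>n. openin (top_of_set (X_sub n)) (T \<inter> X_sub n))"
    show "S \<inter> T \<subseteq> X_space"
      using S by blast
    have "openin (top_of_set (X_sub n)) ((S \<inter> X_sub n) \<inter> (T \<inter> X_sub n))"
      by (rule openin_Int) (use S T in simp_all)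
    also have "(S \<inter> X_sub n) \<inter> (T \<inter> X_sub n) = S \<inter> T \<inter> X_sub n"
      by blast
    finally show "openin (top_of_set (X_sub n)) (S \<inter> T \<inter> X_sub n)" .
  next
    fix \<K> n
    assume K: "\<forall>U\<in>\<K>. U \<subseteq> X_space \<and> (\<forall>n. openin (top_of_set (X_sub n)) (U \<inter> X_sub n))"
    show "\<Union>\<K> \<subseteq> X_space"
      using K by blast
    have "openin (top_of_set (X_sub n)) (\<Union>((\<lambda>U. U \<inter> X_sub n) ` \<K>))"
      using K by (intro openin_Union) (simp add: image_iff, blast)
    also have "\<Union>((\<lambda>U. U \<inter> X_sub n) ` \<K>) = \<Union>\<K> \<inter> X_sub n"
      by blast
    finally show "openin (top_of_set (X_sub n)) (\<Union>\<K> \<inter> X_sub n)" .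
  qed
  then show ?thesis
    by (simp add: X_top_def topology_inverse')
qed

lemma topspace_X_top: "topspace X_top = X_space"
proof -
  have "X_space \<inter> X_sub n = X_sub n" for n
    by (auto simp: X_space_def)
  then have "openin X_top X_space"
    by (simp add: openin_X_top)
  then have "X_space \<subseteq> topspace X_top"
    by (rule openin_subset)
  moreover have "topspace X_top \<subseteq> X_space"
    using openin_topspace[of X_top, unfolded openin_X_top] by blast
  ultimately show ?thesis
    by simp
qed

text \<open>A functional on \<open>X\<close> is represented by a function on \<open>l2\<close> that vanishes off \<open>X\<close>, so that equality
  of functionals is equality of functions. The pairing \<open>\<langle>\<mu> | f\<rangle>\<close> is \<open>\<mu> f\<close>.\<close>

definition X_dual :: "(l2 \<Rightarrow> complex) set" where
  "X_dual = {\<mu>.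
     (\<forall>f\<in>X_space. \<forall>g\<in>X_space. \<mu> (f + g) = \<mu> f + \<mu> g) \<and>
     (\<forall>c. \<forall>f\<in>X_space. \<mu> (cscale c f) = cnj c * \<mu> f) \<and>
     continuous_map X_top euclidean \<mu> \<and>
     (\<forall>f. f \<notin> X_space \<longrightarrow> \<mu> f = 0)}"

text \<open>The library topology on a function type is that of pointwise convergence; off \<open>X\<close> all
  functionals in \<open>X_dual\<close> agree, so this is the weak* topology.\<close>

definition weak_star :: "(l2 \<Rightarrow> complex) topology" where
  "weak_star = top_of_set X_dual"

definition gelfand_embed :: "l2 \<Rightarrow> l2 \<Rightarrow> complex" where
  "gelfand_embed g = (\<lambda>f. if f \<in> X_space then cinner g f else 0)"

definition Phi :: "nat \<Rightarrow> l2" where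
  "Phi n = (THE \<phi>. \<phi> \<noteq> 0 \<and> perron_frobenius \<phi> = cscale ((1/2) ^ n) \<phi> \<and>
     (\<exists>p. degree p = n \<and> lead_coeff p = 1 \<and> \<phi> = poly_h p))"

definition Phi_dual :: "nat \<Rightarrow> l2 \<Rightarrow> complex" where
  "Phi_dual i = (THE \<mu>. \<mu> \<in> X_dual \<and> (\<forall>j. \<mu> (Phi j) = (if i = j then 1 else 0)))"

definition dual_koopman :: "(l2 \<Rightarrow> complex) \<Rightarrow> l2 \<Rightarrow> complex" where
  "dual_koopman \<mu> = (\<lambda>f. if f \<in> X_space then \<mu> (perron_frobenius f) else 0)"


section \<open>Generalized spectrum\<close>

text \<open>Analytic continuation, across the unit circle, of the resolvent as an operator from \<open>X\<close> into
  \<open>X'\<close> (holomorphic in the weak* sense) to a domain \<open>\<Omega>\<close>. Connectedness of \<open>\<Omega>\<close> makes \<open>R\<close> unique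
  on \<open>\<Omega>\<close>.\<close>

definition resolvent_continuation :: "complex set \<Rightarrow> (complex \<Rightarrow> l2 \<Rightarrow> l2 \<Rightarrow> complex) \<Rightarrow> bool" where
  "resolvent_continuation \<Omega> R \<longleftrightarrow>
     open \<Omega> \<and> connected \<Omega> \<and> {l. cmod l > 1} \<subseteq> \<Omega> \<and> \<Omega> \<inter> ball 0 1 \<noteq> {} \<and>
     (\<forall>l\<in>\<Omega>. \<forall>f\<in>X_space. R l f \<in> X_dual) \<and>
     (\<forall>l\<in>\<Omega>. \<forall>f\<in>X_space. \<forall>g\<in>X_space. \<forall>k. R l (f + g) k = R l f k + R l g k) \<and>
     (\<forall>l\<in>\<Omega>. \<forall>c. \<forall>f\<in>X_space. \<forall>k. R l (cscale c f) k = c * R l f k) \<and>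
     (\<forall>f\<in>X_space. \<forall>g\<in>X_space. (\<lambda>l. R l f g) holomorphic_on \<Omega>) \<and>
     (\<forall>l f. cmod l > 1 \<and> f \<in> X_space \<longrightarrow> R l f = gelfand_embed (resolvent l f))"

text \<open>The generalized resolvent lives on a maximal domain, so that every point outside \<open>\<Omega>\<close> is a
  singularity: the generalized spectrum is \<open>- \<Omega>\<close>.\<close>

definition generalized_resolvent :: "complex set \<Rightarrow> (complex \<Rightarrow> l2 \<Rightarrow> l2 \<Rightarrow> complex) \<Rightarrow> bool" where
  "generalized_resolvent \<Omega> R \<longleftrightarrow> resolvent_continuation \<Omega> R \<and>
     (\<forall>\<Omega>' R'. resolvent_continuation \<Omega>' R' \<and> \<Omega> \<subseteq> \<Omega>' \<longrightarrow> \<Omega>' = \<Omega>)"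

definition generalized_spectrum :: "complex set \<Rightarrow> complex set" where
  "generalized_spectrum \<Omega> = - \<Omega>"

definition isolated_singularity :: "complex set \<Rightarrow> complex \<Rightarrow> bool" where
  "isolated_singularity \<Omega> l0 \<longleftrightarrow> l0 \<in> generalized_spectrum \<Omega> \<and>
     (\<exists>r>0. generalized_spectrum \<Omega> \<inter> ball l0 r = {l0})"

definition encircles_only :: "complex set \<Rightarrow> (real \<Rightarrow> complex) \<Rightarrow> complex \<Rightarrow> bool" where
  "encircles_only \<Omega> \<gamma> l0 \<longleftrightarrow>
     valid_path \<gamma> \<and> simple_path \<gamma> \<and> pathfinish \<gamma> = pathstart \<gamma> \<and> path_image \<gamma> \<subseteq> \<Omega> \<and>
     winding_number \<gamma> l0 = 1 \<and>
     (\<forall>l \<in> generalized_spectrum \<Omega> - {l0}. winding_number \<gamma> l = 0)"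

text \<open>By Cauchy's theorem the integral does not depend on the curve chosen.\<close>

definition riesz_projection ::
    "complex set \<Rightarrow> (complex \<Rightarrow> l2 \<Rightarrow> l2 \<Rightarrow> complex) \<Rightarrow> complex \<Rightarrow> l2 \<Rightarrow> l2 \<Rightarrow> complex" where
  "riesz_projection \<Omega> R l0 f = (\<lambda>g. 1 / (2 * of_real pi * \<i>) *
     contour_integral (SOME \<gamma>. encircles_only \<Omega> \<gamma> l0) (\<lambda>z. R z f g))"

definition generalized_eigenspace ::
    "complex set \<Rightarrow> (complex \<Rightarrow> l2 \<Rightarrow> l2 \<Rightarrow> complex) \<Rightarrow> complex \<Rightarrow> (l2 \<Rightarrow> complex) set" where
  "generalized_eigenspace \<Omega> R l0 = riesz_projection \<Omega> R l0 ` X_space"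

definition generalized_eigenvectors ::
    "complex set \<Rightarrow> (complex \<Rightarrow> l2 \<Rightarrow> l2 \<Rightarrow> complex) \<Rightarrow> complex \<Rightarrow> (l2 \<Rightarrow> complex) set" where
  "generalized_eigenvectors \<Omega> R l0 = generalized_eigenspace \<Omega> R l0 - {\<lambda>_. 0}"

definition generalized_eigenvalue ::
    "complex set \<Rightarrow> (complex \<Rightarrow> l2 \<Rightarrow> l2 \<Rightarrow> complex) \<Rightarrow> complex \<Rightarrow> bool" where
  "generalized_eigenvalue \<Omega> R l0 \<longleftrightarrow>
     isolated_singularity \<Omega> l0 \<and> generalized_eigenvectors \<Omega> R l0 \<noteq> {}"

end

theory Submission
  imports Defs
begin

text \<open>The Perron-Frobenius operator averages over the two inverse branches of the shift, which are affine in
  \<open>h\<close>. On polynomials in \<open>h\<close> it is therefore triangular with diagonal entries \<open>2\<^sup>-\<^sup>n\<close>, so it is diagonalized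
  by the \<open>\<Phi>\<^sub>n\<close>. In these coordinates the resolvent is the finite sum of the terms \<open>c\<^sub>i / (\<lambda> - 2\<^sup>-\<^sup>i) \<Phi>\<^sub>i\<close>, which
  continues to the complement of \<open>{0} \<union> {2\<^sup>-\<^sup>k}\<close> and no further. The Riesz projections pick out the
  coordinates, and on each polynomial both spectral series are finite.\<close>

section \<open>The Perron-Frobenius operator as an average over inverse branches\<close>

text \<open>Everything rests on the uniqueness of the polynomial behind an element of
  \<open>X_space\<close>: without it the degree and leading coefficient of a vector of
  \<open>l2\<close> mean nothing, and the \<open>THE\<close> in \<open>Phi\<close> cannot be
  resolved. It is derived from invariance under the two branches rather than from the distribution
  of \<open>h_map\<close>. A second obstacle is that the claim concerns all maximal continuations.
  Every continuation domain lies in one fixed open set that itself carries a continuation, so the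
  maximal domain is unique, and by the identity theorem so is the operator on X; the spectral data
  are then read off one explicit pair. The topology of X is tested on finite-dimensional subspaces,
  so every antilinear functional is continuous and the dual basis consists of plain
  coordinates.\<close>

interpretation coin: prob_space "uniform_count_measure (UNIV :: bool set)"
  by (rule prob_space_coin)

interpretation coin_pair: pair_sigma_finite "uniform_count_measure (UNIV :: bool set)" mu_plus
  by unfold_locales

interpretation coin_seq: sequence_space "uniform_count_measure (UNIV :: bool set)"
  by unfold_locales

lemma measurable_prepend_pair [measurable]:
  "(\<lambda>(b, \<omega>). case_nat b \<omega>) \<in>
     measurable (uniform_count_measure (UNIV :: bool set) \<Otimes>\<^sub>M mu_plus) mu_plus"
  unfolding mu_plus_def
  using measurable_case_nat'[of fst "uniform_count_measure (UNIV :: bool set) \<Otimes>\<^sub>M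
      (\<Pi>\<^sub>M i\<in>UNIV. uniform_count_measure (UNIV :: bool set))" _ snd]
  by (simp add: case_prod_beta')

text \<open>Independence of the first symbol and the tail; null sets, integrability and integrals
  along the branches are all derived from it.\<close>

lemma distr_prepend:
  "distr (uniform_count_measure (UNIV :: bool set) \<Otimes>\<^sub>M mu_plus) mu_plus (\<lambda>(b, \<omega>). case_nat b \<omega>)
     = mu_plus"
  unfolding mu_plus_def by (rule coin_seq.PiM_iter)

text \<open>Both symbols have positive mass, so what Fubini gives for almost every symbol holds on
  each branch separately.\<close>

lemma AE_coin_iff: "(AE b in uniform_count_measure (UNIV :: bool set). P b) \<longleftrightarrow> (\<forall>b. P b)"
  unfolding uniform_count_measure_def AE_point_measure by (simp add: zero_less_iff_neq_zero)

lemma measurable_prepend [measurable]: "case_nat b \<in> measurable mu_plus mu_plus"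
proof -
  have "(\<lambda>\<omega>. (\<lambda>(b, \<omega>). case_nat b \<omega>) (b, \<omega>)) \<in> measurable mu_plus mu_plus"
    by (rule measurable_compose[OF _ measurable_prepend_pair])
       (auto simp: space_uniform_count_measure intro!: measurable_Pair1')
  then show ?thesis by simp
qed

lemma AE_prepend:
  assumes "AE \<omega> in mu_plus. P \<omega>"
  shows "AE \<omega> in mu_plus. P (case_nat b \<omega>)"
proof -
  have "AE \<omega> in distr (uniform_count_measure (UNIV :: bool set) \<Otimes>\<^sub>M mu_plus) mu_plus
      (\<lambda>(b, \<omega>). case_nat b \<omega>). P \<omega>"
    using assms by (simp only: distr_prepend)
  then have "AE z in uniform_count_measure (UNIV :: bool set) \<Otimes>\<^sub>M mu_plus.
      P ((\<lambda>(b, \<omega>). case_nat b \<omega>) z)"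
    by (rule AE_distrD[OF measurable_prepend_pair])
  from coin_pair.AE_pair[OF this] show ?thesis
    by (simp add: AE_coin_iff)
qed

lemma
  fixes f :: "sigma_plus \<Rightarrow> 'a :: {banach, second_countable_topology}"
  assumes "integrable mu_plus f"
  shows integrable_pair_prepend: "integrable (uniform_count_measure (UNIV :: bool set) \<Otimes>\<^sub>M mu_plus)
      (\<lambda>z. f ((\<lambda>(b, \<omega>). case_nat b \<omega>) z))"
    and integrable_prepend: "integrable mu_plus (\<lambda>\<omega>. f (case_nat b \<omega>))"
proof -
  have "integrable (distr (uniform_count_measure (UNIV :: bool set) \<Otimes>\<^sub>M mu_plus) mu_plus
      (\<lambda>(b, \<omega>). case_nat b \<omega>)) f"
    using assms by (simp only: distr_prepend)
  then show *: "integrable (uniform_count_measure (UNIV :: bool set) \<Otimes>\<^sub>M mu_plus)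
      (\<lambda>z. f ((\<lambda>(b, \<omega>). case_nat b \<omega>) z))"
    by (rule integrable_distr[OF measurable_prepend_pair])
  from coin_pair.AE_integrable_fst'[OF *] show "integrable mu_plus (\<lambda>\<omega>. f (case_nat b \<omega>))"
    by (simp add: AE_coin_iff)
qed

lemma integral_mu_plus_prepend:
  fixes f :: "sigma_plus \<Rightarrow> complex"
  assumes f: "integrable mu_plus f"
  shows "(\<integral>\<omega>. f \<omega> \<partial>mu_plus) =
    ((\<integral>\<omega>. f (case_nat False \<omega>) \<partial>mu_plus) + (\<integral>\<omega>. f (case_nat True \<omega>) \<partial>mu_plus)) / 2"
proof -
  have [measurable]: "f \<in> borel_measurable mu_plus"
    using f by simp
  have "(\<integral>\<omega>. f \<omega> \<partial>mu_plus) = (\<integral>\<omega>. f \<omega> \<partial>distr (uniform_count_measure (UNIV :: bool set) \<Otimes>\<^sub>M mu_plus)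
      mu_plus (\<lambda>(b, \<omega>). case_nat b \<omega>))"
    by (simp only: distr_prepend)
  also have "\<dots> = (\<integral>z. f ((\<lambda>(b, \<omega>). case_nat b \<omega>) z)
      \<partial>(uniform_count_measure (UNIV :: bool set) \<Otimes>\<^sub>M mu_plus))"
    by (rule integral_distr) measurable
  also have "\<dots> = (\<integral>b. (\<integral>\<omega>. f (case_nat b \<omega>) \<partial>mu_plus) \<partial>uniform_count_measure (UNIV :: bool set))"
    using coin_pair.integral_fst'[OF integrable_pair_prepend[OF f]] by simp
  also have "\<dots> = (\<Sum>b\<in>(UNIV :: bool set). (1/2) *\<^sub>R (\<integral>\<omega>. f (case_nat b \<omega>) \<partial>mu_plus))"
    unfolding uniform_count_measure_def by (subst lebesgue_integral_point_measure_finite) auto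
  finally show ?thesis
    by (simp add: UNIV_bool scaleR_conv_of_real field_simps)
qed

lemma square_integrable_prepend:
  assumes "square_integrable f"
  shows "square_integrable (\<lambda>\<omega>. f (case_nat b \<omega>))"
  using assms integrable_prepend[of "\<lambda>\<omega>. (cmod (f \<omega>))\<^sup>2" b]
    measurable_compose[OF measurable_prepend[of b], of f borel]
  by (auto simp: square_integrable_def)

lemma shift_prepend [simp]: "shift_map (case_nat b \<omega>) = \<omega>"
  by (simp add: shift_map_def)

lemma h_prepend: "h_map (case_nat b \<omega>) = (of_bool b + h_map \<omega>) / 2"
proof -
  have "h_map (case_nat b \<omega>) = of_bool b / 2 +
      (\<Sum>i. of_bool (case_nat b \<omega> (Suc i)) * (1/2 :: real) ^ Suc (Suc i))"
    unfolding h_map_def using suminf_split_head[OF summable_h[of "case_nat b \<omega>"]] by simp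
  also have "(\<Sum>i. of_bool (case_nat b \<omega> (Suc i)) * (1/2 :: real) ^ Suc (Suc i)) = (1/2) * h_map \<omega>"
    unfolding h_map_def
    by (subst suminf_mult[OF summable_h, symmetric]) (simp add: mult_ac)
  finally show ?thesis
    by (simp add: field_simps)
qed

lift_definition branch :: "bool \<Rightarrow> l2 \<Rightarrow> l2" is "\<lambda>b f \<omega>. f (case_nat b \<omega>)"
  by (elim conjE, intro conjI square_integrable_prepend, assumption+) (rule AE_prepend)

text \<open>Split off the first symbol: the shift undoes either branch, so only \<open>g\<close>
  still depends on that symbol.\<close>

lemma cinner_koopman_branch:
  "cinner (koopman f) g = (cinner f (branch False g) + cinner f (branch True g)) / 2"
proof transfer
  fix f g :: "sigma_plus \<Rightarrow> complex"
  assume "square_integrable f \<and> square_integrable f \<and> (AE \<omega> in mu_plus. f \<omega> = f \<omega>)"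
    "square_integrable g \<and> square_integrable g \<and> (AE \<omega> in mu_plus. g \<omega> = g \<omega>)"
  then have "integrable mu_plus (\<lambda>\<omega>. f (shift_map \<omega>) * cnj (g \<omega>))"
    by (auto intro: integrable_mult_cnj square_integrable_shift)
  from integral_mu_plus_prepend[OF this]
  show "(\<integral>\<omega>. f (shift_map \<omega>) * cnj (g \<omega>) \<partial>mu_plus) =
      ((\<integral>\<omega>. f \<omega> * cnj (g (case_nat False \<omega>)) \<partial>mu_plus) +
       (\<integral>\<omega>. f \<omega> * cnj (g (case_nat True \<omega>)) \<partial>mu_plus)) / 2"
    by simp
qed

section \<open>Adjointness, isometry and contraction\<close>

lemma cinner_add_right: "cinner k (f + g) = cinner k f + cinner k g"
  by (metis cinner_add_left cinner_commute complex_cnj_add)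

lemma cinner_cscale_right: "cinner f (cscale c g) = cnj c * cinner f g"
  by (metis cinner_commute cinner_cscale_left complex_cnj_mult)

interpretation l2: vector_space cscale
  by (rule vector_space_cscale)

lemma cinner_diff_left: "cinner (f - g) k = cinner f k - cinner g k"
  by (metis add_diff_cancel_right' cinner_add_left diff_add_cancel)

lemma cinner_diff_right: "cinner k (f - g) = cinner k f - cinner k g"
  by (metis add_diff_cancel_right' cinner_add_right diff_add_cancel)

lemma cinner_zero_left [simp]: "cinner 0 f = 0"
  using cinner_diff_left[of f f f] by simp

lemma cinner_self: "cinner f f = of_real ((norm f)\<^sup>2)"
proof (rule complex_eqI)
  show "Re (cinner f f) = Re (of_real ((norm f)\<^sup>2))"
    by (simp add: power2_norm_eq_inner inner_l2_def)
  have "cinner f f = cnj (cinner f f)"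
    by (rule cinner_commute)
  then show "Im (cinner f f) = Im (of_real ((norm f)\<^sup>2))"
    by (metis Im_complex_of_real Reals_cnj_iff complex_is_Real_iff)
qed

lemma cinner_self_eq_0_iff [simp]: "cinner f f = 0 \<longleftrightarrow> f = 0"
  by (simp add: cinner_self)

text \<open>The \<open>THE\<close> asks for existence and uniqueness of the adjoint. The branch
  formula gives existence; testing two candidates against their own difference gives
  uniqueness.\<close>

lemma perron_frobenius_eq:
  "perron_frobenius f = cscale (1/2) (branch False f + branch True f)"
proof -
  define W where "W f = cscale (1/2) (branch False f + branch True f)" for f
  have W: "cinner (koopman f) g = cinner f (W g)" for f g
    by (simp add: W_def cinner_koopman_branch cinner_cscale_right cinner_add_right)
  have "perron_frobenius = W"
    unfolding perron_frobenius_def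
  proof (rule the_equality)
    fix V assume V: "\<forall>f g. cinner (koopman f) g = cinner f (V g)"
    show "V = W"
    proof
      fix g
      have "cinner (V g - W g) (V g - W g) = 0"
        using V W by (metis cinner_diff_right right_minus_eq)
      then show "V g = W g" by simp
    qed
  qed (use W in blast)
  then have "perron_frobenius f = W f"
    by (rule fun_cong)
  then show ?thesis
    unfolding W_def .
qed

lemma cinner_koopman: "cinner (koopman f) g = cinner f (perron_frobenius g)"
  by (simp add: perron_frobenius_eq cinner_koopman_branch cinner_cscale_right cinner_add_right)

lemma branch_add: "branch b (f + g) = branch b f + branch b g"
  by transfer (simp add: square_integrable_add square_integrable_prepend)

lemma branch_cscale: "branch b (cscale c f) = cscale c (branch b f)"
  by transfer (simp add: square_integrable_scale square_integrable_prepend)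

lemma perron_frobenius_add: "perron_frobenius (f + g) = perron_frobenius f + perron_frobenius g"
  unfolding perron_frobenius_eq branch_add l2.scale_right_distrib by (simp only: add_ac)

lemma perron_frobenius_cscale: "perron_frobenius (cscale c f) = cscale c (perron_frobenius f)"
  unfolding perron_frobenius_eq branch_cscale l2.scale_right_distrib l2.scale_scale
  by (simp only: mult.commute)

lemma branch_koopman [simp]: "branch b (koopman f) = f"
  by transfer simp

lemma norm_cscale: "norm (cscale c f) = cmod c * norm f"
proof -
  have "(of_real ((norm (cscale c f))\<^sup>2) :: complex) = of_real ((cmod c * norm f)\<^sup>2)"
    by (simp only: cinner_self[symmetric] cinner_cscale_left cinner_cscale_right)
       (use complex_norm_square[of c] in \<open>simp add: cinner_self power_mult_distrib mult.commute\<close>)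
  then have "(norm (cscale c f))\<^sup>2 = (cmod c * norm f)\<^sup>2"
    by (simp only: of_real_eq_iff)
  then show ?thesis
    by (simp add: power2_eq_iff_nonneg)
qed

text \<open>Both branches are right inverses of the shift, so \<open>perron_frobenius\<close> is a
  left inverse of \<open>koopman\<close>; adjointness turns this into the isometry.\<close>

lemma norm_koopman: "norm (koopman f) = norm f"
proof -
  have "perron_frobenius (koopman f) = f"
    by (simp add: perron_frobenius_eq l2.scale_right_distrib l2.scale_left_distrib[symmetric])
  then have "cinner (koopman f) (koopman f) = cinner f f"
    by (simp add: cinner_koopman)
  then have "(norm (koopman f))\<^sup>2 = (norm f)\<^sup>2"
    unfolding cinner_self by (simp only: of_real_eq_iff)
  then show ?thesis
    by (simp add: power2_eq_iff_nonneg)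
qed

text \<open>Write the squared norm of Vf as (UVf, f), apply Cauchy-Schwarz, and use that U is
  isometric.\<close>

lemma norm_perron_frobenius_le: "norm (perron_frobenius f) \<le> norm f"
proof -
  let ?V = "perron_frobenius f"
  have "norm ?V * norm ?V = inner (koopman ?V) f"
    using cinner_koopman[of ?V f] by (simp add: inner_l2_def cinner_self power2_eq_square)
  also have "\<dots> \<le> norm ?V * norm f"
    using norm_cauchy_schwarz[of "koopman ?V" f] by (simp add: norm_koopman)
  finally show ?thesis
    by (cases "norm ?V = 0") (auto simp: mult_le_cancel_left)
qed

text \<open>\<open>resolvent\<close> is an \<open>inv\<close> on all of \<open>l2\<close>.
  Injectivity, which follows from the contraction bound, allows it to be evaluated at any vector for
  which a preimage is exhibited.\<close>

lemma inj_scale_minus_perron_frobenius: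
  assumes "cmod l > 1"
  shows "inj (\<lambda>f. cscale l f - perron_frobenius f)"
proof (rule injI)
  fix f g assume eq: "cscale l f - perron_frobenius f = cscale l g - perron_frobenius g"
  define d where "d = f - g"
  have "perron_frobenius f = perron_frobenius d + perron_frobenius g"
    using perron_frobenius_add[of d g] by (simp add: d_def)
  moreover have "cscale l f = cscale l d + cscale l g"
    using l2.scale_right_distrib[of l d g] by (simp add: d_def)
  ultimately have "cscale l d = perron_frobenius d"
    using eq by (simp add: algebra_simps)
  then have "cmod l * norm d \<le> norm d"
    using norm_perron_frobenius_le[of d] norm_cscale[of l d] by simp
  then have "norm d = 0"
    using assms by (auto simp: mult_le_cancel_right2)
  then show "f = g"
    by (simp add: d_def)
qed

section \<open>Polynomials in \<open>h\<close> and the eigenvector basis\<close>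

lemma square_integrable_poly_h: "square_integrable (\<lambda>\<omega>. poly p (of_real (h_map \<omega>)))"
  using rel_funD[OF poly_h.rsp, of p p] by simp

lemma poly_h_add: "poly_h (p + q) = poly_h p + poly_h q"
  by transfer (simp add: square_integrable_add square_integrable_poly_h)

lemma poly_h_smult: "poly_h (smult c p) = cscale c (poly_h p)"
  by transfer (simp add: square_integrable_scale square_integrable_poly_h)

lemma poly_h_eq_0_iff_AE: "poly_h p = 0 \<longleftrightarrow> (AE \<omega> in mu_plus. poly p (of_real (h_map \<omega>)) = 0)"
  by transfer (auto simp: square_integrable_poly_h square_integrable_def)

lemma poly_h_0 [simp]: "poly_h 0 = 0"
  by (simp add: poly_h_eq_0_iff_AE)

lemma poly_h_diff: "poly_h (p - q) = poly_h p - poly_h q"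
  using poly_h_add[of "p - q" q] by (simp add: algebra_simps)

lemma poly_h_sum: "poly_h (sum f A) = (\<Sum>i\<in>A. poly_h (f i))"
  by (induction A rule: infinite_finite_induct) (auto simp: poly_h_add)

lemma branch_poly_h_eqI:
  assumes "\<And>\<omega>. poly p (of_real (h_map (case_nat b \<omega>))) = poly q (of_real (h_map \<omega>))"
  shows "branch b (poly_h p) = poly_h q"
  using assms by transfer (simp add: square_integrable_poly_h)

lemma branch_poly_h: "branch b (poly_h p) = poly_h (pcompose p [:of_bool b / 2, 1 / 2:])"
  by (rule branch_poly_h_eqI) (simp add: poly_pcompose h_prepend add_divide_distrib)

lemma coeff_pcompose_linear_top:
  fixes p :: "'a :: idom poly"
  assumes "\<And>i. i > n \<Longrightarrow> coeff p i = 0" and "b \<noteq> 0"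
  shows "coeff (pcompose p [:a, b:]) n = b ^ n * coeff p n"
    and "i > n \<Longrightarrow> coeff (pcompose p [:a, b:]) i = 0"
proof -
  have deg: "degree p \<le> n"
    using assms(1) by (intro degree_le) auto
  show "i > n \<Longrightarrow> coeff (pcompose p [:a, b:]) i = 0"
    using deg \<open>b \<noteq> 0\<close> by (intro coeff_eq_0) (simp add: degree_pcompose)
  show "coeff (pcompose p [:a, b:]) n = b ^ n * coeff p n"
  proof (cases "degree p = n")
    case True
    then show ?thesis
      using lead_coeff_comp[of "[:a, b:]" p] \<open>b \<noteq> 0\<close> by (simp add: degree_pcompose mult.commute)
  next
    case False
    with deg \<open>b \<noteq> 0\<close> show ?thesis
      by (simp add: coeff_eq_0 degree_pcompose)
  qed
qed

lemma degree_less_coeffI: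
  assumes "\<And>i. i \<ge> n \<Longrightarrow> coeff p i = 0" and "p \<noteq> 0"
  shows "degree p < n"
  using assms leading_coeff_0_iff not_le by blast

text \<open>The kernel of \<open>poly_h\<close> is invariant under both inverse branches. A nonzero element of least
  degree \<open>n\<close> is therefore an eigenvector, with eigenvalue \<open>2\<^sup>-\<^sup>n\<close>, of both substitutions
  \<open>x \<mapsto> x/2\<close> and \<open>x \<mapsto> (x + 1)/2\<close>; the two together make it periodic, hence constant.\<close>

lemma poly_h_eq_0_iff [simp]: "poly_h p = 0 \<longleftrightarrow> p = 0"
proof
  show "poly_h p = 0 \<Longrightarrow> p = 0"
  proof (induction "degree p" arbitrary: p rule: less_induct)
    case less
    show ?case
    proof (rule ccontr)
      assume "p \<noteq> 0"
      define n where "n = degree p"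
      have eq: "smult (2 ^ n) (pcompose p [:of_bool b / 2, 1 / 2:]) = p" for b
      proof (rule ccontr)
        assume neq: "smult (2 ^ n) (pcompose p [:of_bool b / 2, 1 / 2:]) \<noteq> p"
        \<comment> \<open>The factor \<open>2 ^ n\<close> restores the leading coefficient, so
          \<open>r\<close> stays in the kernel while its degree drops, and the induction hypothesis
          applies.\<close>
        define r where "r = smult (2 ^ n) (pcompose p [:of_bool b / 2, 1 / 2:]) - p"
        have "branch b 0 = 0"
          by (metis branch_poly_h pcompose_0 poly_h_0)
        then have "poly_h r = 0"
          using less.prems by (simp add: r_def poly_h_diff poly_h_smult flip: branch_poly_h)
        moreover have "coeff r i = 0" if "i \<ge> n" for i
        proof (cases "i = n")
          case True
          then show ?thesis
            using coeff_pcompose_linear_top(1)[of n p "1/2" "of_bool b / 2"]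
            by (simp add: r_def n_def coeff_eq_0 power_one_over)
        next
          case False
          then show ?thesis
            using that coeff_pcompose_linear_top(2)[of n p "1/2" i "of_bool b / 2"]
            by (simp add: r_def n_def coeff_eq_0)
        qed
        then have "degree r < n"
          using neq by (intro degree_less_coeffI) (auto simp: r_def)
        ultimately have "r = 0"
          using less.hyps by (simp add: n_def)
        with neq show False
          by (simp add: r_def)
      qed
      have halves: "pcompose p [:0, 1 / 2:] = pcompose p [:1 / 2, 1 / 2:]"
        using eq[of False] eq[of True]
        by (metis of_bool_eq(1,2) div_0 power_not_zero smult_cancel zero_neq_numeral)
      \<comment> \<open>At 2x the two substitutions evaluate \<open>p\<close> at x and at x + 1/2,
        so the period is 1/2.\<close>
      have step: "poly p x = poly p (x + 1 / 2)" for x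
        using arg_cong[where f="\<lambda>q. poly q (2 * x)", OF halves] by (simp add: poly_pcompose add.commute)
      have "poly p (of_nat k / 2) = poly p 0" for k
      proof (induction k)
        case (Suc k)
        then show ?case
          using step[of "of_nat k / 2"] by (simp add: add_divide_distrib add.commute)
      qed simp
      then have "range (\<lambda>k. of_nat k / 2 :: complex) \<subseteq> {x. poly (p - [:poly p 0:]) x = 0}"
        by auto
      moreover have "infinite (range (\<lambda>k. of_nat k / 2 :: complex))"
        by (rule range_inj_infinite) (auto simp: inj_on_def)
      ultimately have "p - [:poly p 0:] = 0"
        using poly_roots_finite infinite_super by blast
      then obtain c where c: "p = [:c:]"
        by (metis right_minus_eq)
      have "AE \<omega> in mu_plus. c = 0"
        using less.prems by (simp add: poly_h_eq_0_iff_AE c)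
      with \<open>p \<noteq> 0\<close> show False
        by (simp add: c)
    qed
  qed
qed simp

lemma poly_h_eq_iff [simp]: "poly_h p = poly_h q \<longleftrightarrow> p = q"
  using poly_h_eq_0_iff[of "p - q"] by (simp add: poly_h_diff del: poly_h_eq_0_iff)

section \<open>Triangular action on polynomials\<close>

definition transfer_poly :: "complex poly \<Rightarrow> complex poly" where
  "transfer_poly p = smult (1/2) (pcompose p [:0, 1/2:] + pcompose p [:1/2, 1/2:])"

lemma perron_frobenius_poly_h: "perron_frobenius (poly_h p) = poly_h (transfer_poly p)"
  by (simp add: perron_frobenius_eq branch_poly_h transfer_poly_def poly_h_smult poly_h_add)

lemma transfer_poly_add: "transfer_poly (p + q) = transfer_poly p + transfer_poly q"
  by (simp add: transfer_poly_def pcompose_add smult_add_right)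

lemma transfer_poly_diff: "transfer_poly (p - q) = transfer_poly p - transfer_poly q"
  using transfer_poly_add[of "p - q" q] by simp

lemma coeff_transfer_poly_top:
  assumes "\<And>i. i > n \<Longrightarrow> coeff p i = 0"
  shows "coeff (transfer_poly p) n = (1/2) ^ n * coeff p n"
    and "i > n \<Longrightarrow> coeff (transfer_poly p) i = 0"
  using coeff_pcompose_linear_top[OF assms, of n "1/2"]
  by (auto simp: transfer_poly_def)

text \<open>Back substitution in a triangular system with diagonal entries l - 2^-j, j < n.
  Vanishing of the coefficients from n on expresses degree < n, with n = 0 standing for the zero
  polynomial.\<close>

lemma transfer_poly_solve:
  assumes "\<And>j. j < n \<Longrightarrow> l \<noteq> (1/2) ^ j" and "\<And>i. i \<ge> n \<Longrightarrow> coeff q i = 0"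
  shows "\<exists>p. (\<forall>i\<ge>n. coeff p i = 0) \<and> smult l p - transfer_poly p = q"
  using assms
proof (induction n arbitrary: q)
  case 0
  then have "q = 0"
    by (intro poly_eqI) simp
  then show ?case
    by (intro exI[of _ 0]) (simp add: transfer_poly_def)
next
  case (Suc n)
  \<comment> \<open>The operator multiplies the top coefficient of x^n by l - 2^-n, so this
    \<open>c\<close> removes the term of degree n from \<open>q\<close>.\<close>
  define c where "c = coeff q n / (l - (1/2) ^ n)"
  define q' where "q' = q - (smult l (monom c n) - transfer_poly (monom c n))"
  have "coeff q' i = 0" if "i \<ge> n" for i
  proof (cases "i = n")
    case True
    then show ?thesis
      using Suc.prems(1)[of n] coeff_transfer_poly_top(1)[of n "monom c n"]
      by (simp add: q'_def c_def field_simps)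
  next
    case False
    then show ?thesis
      using that Suc.prems(2)[of i] coeff_transfer_poly_top(2)[of n "monom c n" i]
      by (simp add: q'_def)
  qed
  then obtain p where p: "\<forall>i\<ge>n. coeff p i = 0" "smult l p - transfer_poly p = q'"
    using Suc.IH[of q'] Suc.prems(1) by auto
  show ?case
  proof (intro exI[of _ "p + monom c n"] conjI allI impI)
    show "smult l (p + monom c n) - transfer_poly (p + monom c n) = q"
      using p(2) by (simp add: q'_def transfer_poly_add smult_add_right algebra_simps)
  qed (use p(1) in auto)
qed

lemma half_power_eq_iff: "(1/2 :: complex) ^ m = (1/2) ^ n \<longleftrightarrow> m = n"
proof
  assume "(1/2 :: complex) ^ m = (1/2) ^ n"
  then have "complex_of_nat (2 ^ m) = complex_of_nat (2 ^ n)"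
    by (simp add: power_one_over)
  then have "(2 ^ m :: nat) = 2 ^ n"
    by (simp only: of_nat_eq_iff)
  then show "m = n"
    by simp
qed simp

text \<open>Comparing leading coefficients, a nonzero eigenvector of degree d has eigenvalue 2^-d,
  which differs from 2^-n when d < n.\<close>

lemma transfer_poly_eigen_unique:
  assumes "transfer_poly p = smult ((1/2) ^ n) p" and "\<And>i. i \<ge> n \<Longrightarrow> coeff p i = 0"
  shows "p = 0"
proof (rule ccontr)
  assume "p \<noteq> 0"
  then have "degree p < n"
    using assms(2) by (intro degree_less_coeffI)
  moreover have "(1/2) ^ n * lead_coeff p = (1/2) ^ degree p * lead_coeff p"
    using coeff_transfer_poly_top(1)[of "degree p" p] assms(1) by (simp add: coeff_eq_0)
  then have "((1/2) ^ n :: complex) = (1/2) ^ degree p"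
    using \<open>p \<noteq> 0\<close> by simp
  then have "n = degree p"
    by (simp only: half_power_eq_iff)
  ultimately show False by simp
qed

text \<open>The monomial x^n satisfies the eigenvalue equation up to terms of lower degree, and
  there 2^-n minus the operator can be inverted.\<close>

lemma transfer_poly_eigen_exists:
  "\<exists>p. transfer_poly p = smult ((1/2) ^ n) p \<and> degree p = n \<and> lead_coeff p = 1"
proof -
  define q where "q = transfer_poly (monom 1 n) - smult ((1/2) ^ n) (monom 1 n)"
  have "coeff q i = 0" if "i \<ge> n" for i
    using that coeff_transfer_poly_top[of n "monom 1 n"] by (cases "i = n") (auto simp: q_def)
  moreover have "((1/2) ^ n :: complex) \<noteq> (1/2) ^ j" if "j < n" for j
    using that by (simp add: half_power_eq_iff)
  ultimately obtain r where r: "\<forall>i\<ge>n. coeff r i = 0" "smult ((1/2) ^ n) r - transfer_poly r = q"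
    using transfer_poly_solve[of n "(1/2) ^ n" q] by auto
  define p where "p = monom 1 n + r"
  have "coeff p n = 1" "\<And>i. i > n \<Longrightarrow> coeff p i = 0"
    using r(1) by (auto simp: p_def)
  then have "degree p = n"
    by (metis degree_le le_antisym le_degree zero_neq_one)
  moreover have "transfer_poly p = smult ((1/2) ^ n) p"
    using r(2) by (simp add: p_def q_def transfer_poly_add smult_add_right algebra_simps)
  ultimately show ?thesis
    using \<open>coeff p n = 1\<close> by blast
qed

text \<open>This is the n-th Bernoulli polynomial, by the multiplication formula B_n(x/2) +
  B_n((x+1)/2) = 2^(1-n) B_n(x).\<close>

definition eigen_poly :: "nat \<Rightarrow> complex poly" where
  "eigen_poly n = (SOME p. transfer_poly p = smult ((1/2) ^ n) p \<and> degree p = n \<and> lead_coeff p = 1)"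

lemma eigen_poly:
  "transfer_poly (eigen_poly n) = smult ((1/2) ^ n) (eigen_poly n)"
  "degree (eigen_poly n) = n" "coeff (eigen_poly n) n = 1"
  using someI_ex[OF transfer_poly_eigen_exists[of n], folded eigen_poly_def] by auto

text \<open>Injectivity of \<open>poly_h\<close> moves the eigenvalue equation from
  \<open>l2\<close> to polynomials, where two monic solutions differ by a solution of lower degree,
  hence by 0.\<close>

lemma Phi_eq: "Phi n = poly_h (eigen_poly n)"
  unfolding Phi_def
proof (rule the_equality, intro conjI)
  show "poly_h (eigen_poly n) \<noteq> 0"
    using eigen_poly(3)[of n] by auto
  show "perron_frobenius (poly_h (eigen_poly n)) = cscale ((1/2) ^ n) (poly_h (eigen_poly n))"
    by (simp add: perron_frobenius_poly_h eigen_poly(1) poly_h_smult)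
  show "\<exists>p. degree p = n \<and> lead_coeff p = 1 \<and> poly_h (eigen_poly n) = poly_h p"
    using eigen_poly by metis
next
  fix \<phi> assume "\<phi> \<noteq> 0 \<and> perron_frobenius \<phi> = cscale ((1/2) ^ n) \<phi> \<and>
     (\<exists>p. degree p = n \<and> lead_coeff p = 1 \<and> \<phi> = poly_h p)"
  then obtain p where eigen: "perron_frobenius \<phi> = cscale ((1/2) ^ n) \<phi>"
    and p: "degree p = n" "lead_coeff p = 1" "\<phi> = poly_h p"
    by blast
  have "poly_h (transfer_poly p) = poly_h (smult ((1/2) ^ n) p)"
    using eigen by (simp only: p(3) perron_frobenius_poly_h poly_h_smult)
  then have eigen_p: "transfer_poly p = smult ((1/2) ^ n) p"
    by (simp only: poly_h_eq_iff)
  have "p - eigen_poly n = 0"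
  proof (rule transfer_poly_eigen_unique)
    show "transfer_poly (p - eigen_poly n) = smult ((1/2) ^ n) (p - eigen_poly n)"
      by (simp only: eigen_p transfer_poly_diff eigen_poly(1) smult_diff_right)
    show "coeff (p - eigen_poly n) i = 0" if "i \<ge> n" for i
      using that p(1,2) eigen_poly(2,3)[of n] by (cases "i = n") (auto simp: coeff_eq_0)
  qed
  then show "\<phi> = poly_h (eigen_poly n)"
    using p(3) by simp
qed

section \<open>The eigenvectors as a basis of X\<close>

lemma X_space_eq: "X_space = range poly_h"
  by (auto simp: X_space_def X_sub_def)

lemma X_space_add: "f \<in> X_space \<Longrightarrow> g \<in> X_space \<Longrightarrow> f + g \<in> X_space"
  by (auto simp: X_space_eq simp flip: poly_h_add)

lemma X_space_cscale: "f \<in> X_space \<Longrightarrow> cscale c f \<in> X_space"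
  by (auto simp: X_space_eq simp flip: poly_h_smult)

lemma Phi_in_X_space: "Phi n \<in> X_space"
  by (simp add: Phi_eq X_space_eq)

lemma Phi_neq_0: "Phi n \<noteq> 0"
  using eigen_poly(3)[of n] by (auto simp: Phi_eq)

lemma perron_frobenius_Phi: "perron_frobenius (Phi n) = cscale ((1/2) ^ n) (Phi n)"
  by (simp add: Phi_eq perron_frobenius_poly_h eigen_poly(1) poly_h_smult)

text \<open>The isomorphism of \<open>\<complex>[x]\<close> onto \<open>X\<close> that takes \<open>x\<^sup>i\<close> to \<open>\<Phi>\<^sub>i\<close>; it turns \<open>V\<^sub>S\<close> into the substitution
  \<open>x \<mapsto> x/2\<close>.\<close>

definition Phi_comb :: "complex poly \<Rightarrow> l2" where
  "Phi_comb p = (\<Sum>i\<le>degree p. cscale (coeff p i) (Phi i))"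

lemma Phi_comb_eq:
  assumes "degree p \<le> n"
  shows "Phi_comb p = (\<Sum>i\<le>n. cscale (coeff p i) (Phi i))"
  unfolding Phi_comb_def using assms by (intro sum.mono_neutral_left) (auto simp: coeff_eq_0)

lemma Phi_comb_add: "Phi_comb (p + q) = Phi_comb p + Phi_comb q"
proof -
  let ?n = "max (degree p) (degree q)"
  have "degree (p + q) \<le> ?n"
    by (rule degree_add_le_max)
  then show ?thesis
    by (simp add: Phi_comb_eq[of _ ?n] l2.scale_left_distrib sum.distrib)
qed

lemma Phi_comb_smult: "Phi_comb (smult c p) = cscale c (Phi_comb p)"
  using degree_smult_le[of c p] by (simp add: Phi_comb_eq[of _ "degree p"] l2.scale_sum_right)

lemma Phi_comb_monom: "Phi_comb (monom c n) = cscale c (Phi n)"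
proof -
  have "Phi_comb (monom c n) = (\<Sum>i\<le>n. cscale (if n = i then c else 0) (Phi i))"
    using degree_monom_le[of c n] by (simp add: Phi_comb_eq[of _ n])
  also have "\<dots> = (\<Sum>i\<le>n. if i = n then cscale c (Phi i) else 0)"
    by (rule sum.cong) auto
  finally show ?thesis
    by simp
qed

lemma Phi_comb_diff: "Phi_comb (p - q) = Phi_comb p - Phi_comb q"
  using Phi_comb_add[of "p - q" q] by (simp add: algebra_simps)

lemma Phi_comb_eq_0_iff: "Phi_comb p = 0 \<longleftrightarrow> p = 0"
proof
  assume "Phi_comb p = 0"
  define q where "q = (\<Sum>i\<le>degree p. smult (coeff p i) (eigen_poly i))"
  have "poly_h q = Phi_comb p"
    by (simp add: q_def Phi_comb_def poly_h_sum poly_h_smult Phi_eq)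
  then have "q = 0"
    using \<open>Phi_comb p = 0\<close> by simp
  \<comment> \<open>Only the last summand reaches degree \<open>degree p\<close>, and its
    eigenpolynomial is monic, so \<open>q\<close> inherits the leading coefficient of
    \<open>p\<close>.\<close>
  have "coeff (eigen_poly i) (degree p) = (if i = degree p then 1 else 0)" if "i \<le> degree p" for i
    using that eigen_poly(2,3)[of i] by (auto simp: coeff_eq_0)
  then have "coeff q (degree p) = (\<Sum>i\<le>degree p. if i = degree p then coeff p i else 0)"
    unfolding q_def coeff_sum by (intro sum.cong) auto
  with \<open>q = 0\<close> show "p = 0"
    by simp
qed (simp add: Phi_comb_def)

lemma inj_Phi_comb: "inj Phi_comb"
  by (rule injI) (metis Phi_comb_diff Phi_comb_eq_0_iff right_minus_eq)

text \<open>Eliminate the leading term with the monic eigenpolynomial of that degree. The bound n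
  exceeds the degree strictly, hence the final \<open>Suc (degree p)\<close>.\<close>

lemma poly_h_in_range_Phi_comb: "poly_h p \<in> range Phi_comb"
proof -
  have "poly_h p \<in> range Phi_comb" if "\<And>i. i \<ge> n \<Longrightarrow> coeff p i = 0" for n p
    using that
  proof (induction n arbitrary: p)
    case 0
    then have "p = 0"
      by (intro poly_eqI) simp
    then have "poly_h p = Phi_comb 0"
      by (simp add: Phi_comb_eq_0_iff)
    then show ?case by simp
  next
    case (Suc n)
    define r where "r = p - smult (coeff p n) (eigen_poly n)"
    have "coeff r i = 0" if "i \<ge> n" for i
      using that Suc.prems eigen_poly(2,3)[of n] by (cases "i = n") (auto simp: r_def coeff_eq_0)
    then obtain q where "poly_h r = Phi_comb q"
      using Suc.IH by auto
    then have "poly_h p = Phi_comb (q + monom (coeff p n) n)"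
      by (simp add: Phi_comb_add Phi_comb_monom r_def poly_h_diff poly_h_smult Phi_eq algebra_simps)
    then show ?case by simp
  qed
  from this[of "Suc (degree p)"] show ?thesis
    by (simp add: coeff_eq_0 Suc_le_eq)
qed

lemma range_Phi_comb: "range Phi_comb = X_space"
proof
  have "Phi_comb p = poly_h (\<Sum>i\<le>degree p. smult (coeff p i) (eigen_poly i))" for p
    by (simp add: Phi_comb_def poly_h_sum poly_h_smult Phi_eq)
  then show "range Phi_comb \<subseteq> X_space"
    by (auto simp: X_space_eq)
  show "X_space \<subseteq> range Phi_comb"
    using poly_h_in_range_Phi_comb by (auto simp: X_space_eq)
qed

lemma perron_frobenius_Phi_comb:
  "perron_frobenius (Phi_comb p) = Phi_comb (pcompose p [:0, 1/2:])"
proof -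
  have zero: "perron_frobenius 0 = 0"
    using perron_frobenius_cscale[of 0 0] by simp
  have "perron_frobenius (sum f A) = (\<Sum>i\<in>A. perron_frobenius (f i))" for f :: "nat \<Rightarrow> l2" and A
    by (induction A rule: infinite_finite_induct) (auto simp: perron_frobenius_add zero)
  then have "perron_frobenius (Phi_comb p) =
      (\<Sum>i\<le>degree p. cscale (coeff (pcompose p [:0, 1/2:]) i) (Phi i))"
    by (simp add: Phi_comb_def perron_frobenius_cscale perron_frobenius_Phi coeff_pcompose_linear
        mult.commute)
  then show ?thesis
    by (simp add: Phi_comb_def degree_pcompose)
qed

section \<open>The dual space\<close>

text \<open>Gram-Schmidt: a functional on \<open>X\<^sub>n\<close> is represented by an inner product, because the one on
  \<open>X\<^sub>n\<^sub>-\<^sub>1\<close> is, and because representing \<open>(h\<^sup>n, \<cdot>)\<close> there gives a vector of \<open>X\<^sub>n\<close> orthogonal to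
  \<open>X\<^sub>n\<^sub>-\<^sub>1\<close>.\<close>

lemma antilinear_representation:
  assumes "\<And>f g. f \<in> X_space \<Longrightarrow> g \<in> X_space \<Longrightarrow> \<mu> (f + g) = \<mu> f + \<mu> g"
    and "\<And>c f. f \<in> X_space \<Longrightarrow> \<mu> (cscale c f) = cnj c * \<mu> f"
  shows "\<exists>q. (\<forall>i\<ge>n. coeff q i = 0) \<and>
    (\<forall>p. (\<forall>i\<ge>n. coeff p i = 0) \<longrightarrow> \<mu> (poly_h p) = cinner (poly_h q) (poly_h p))"
  using assms
proof (induction n arbitrary: \<mu>)
  case (0 \<mu>)
  have "\<mu> 0 = 0"
    using 0(2)[of "poly_h 0" 0] by (simp add: X_space_eq)
  moreover have "p = 0" if "\<forall>i\<ge>0. coeff p i = 0" for p :: "complex poly"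
    using that by (intro poly_eqI) simp
  ultimately show ?case
    by (intro exI[of _ 0]) (metis coeff_0 cinner_zero_left poly_h_0)
next
  case (Suc n \<mu>)
  obtain r where r: "\<forall>i\<ge>n. coeff r i = 0"
    "\<And>p. \<forall>i\<ge>n. coeff p i = 0 \<Longrightarrow>
      cinner (poly_h (monom 1 n)) (poly_h p) = cinner (poly_h r) (poly_h p)"
    using Suc.IH[of "cinner (poly_h (monom 1 n))"] by (auto simp: cinner_add_right cinner_cscale_right)
  obtain q where q: "\<forall>i\<ge>n. coeff q i = 0"
    "\<And>p. \<forall>i\<ge>n. coeff p i = 0 \<Longrightarrow> \<mu> (poly_h p) = cinner (poly_h q) (poly_h p)"
    using Suc.IH[of \<mu>] Suc.prems by auto
  define w where "w = monom 1 n - r"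
  have w_coeff: "coeff w n = 1" "\<And>i. i > n \<Longrightarrow> coeff w i = 0"
    using r(1) by (auto simp: w_def)
  then have "w \<noteq> 0"
    by auto
  then have ww: "cinner (poly_h w) (poly_h w) \<noteq> 0"
    by simp
  have orth: "cinner (poly_h w) (poly_h p) = 0" if "\<forall>i\<ge>n. coeff p i = 0" for p
    using r(2)[OF that] by (simp add: w_def poly_h_diff cinner_diff_left)
  then have orth': "cinner (poly_h q) (poly_h w) = 0"
    using q(1) by (metis cinner_commute complex_cnj_zero)
  \<comment> \<open>\<open>w\<close> is orthogonal to all lower degrees, so the correction by a
    multiple of \<open>w\<close> is fixed by the value at \<open>w\<close> alone.\<close>
  define a where "a = \<mu> (poly_h w) / cinner (poly_h w) (poly_h w)"
  show ?case
  proof (intro exI[of _ "q + smult a w"] conjI allI impI)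
    show "coeff (q + smult a w) i = 0" if "i \<ge> Suc n" for i
      using that q(1) w_coeff(2) by auto
    fix p :: "complex poly" assume p: "\<forall>i\<ge>Suc n. coeff p i = 0"
    define p0 where "p0 = p - smult (coeff p n) w"
    have p0: "\<forall>i\<ge>n. coeff p0 i = 0"
    proof (intro allI impI)
      fix i assume "i \<ge> n"
      then show "coeff p0 i = 0"
        using p w_coeff by (cases "i = n") (auto simp: p0_def)
    qed
    have p_eq: "poly_h p = poly_h p0 + cscale (coeff p n) (poly_h w)"
      by (simp add: p0_def poly_h_diff poly_h_smult)
    have X: "poly_h p \<in> X_space" for p
      by (simp add: X_space_eq)
    have "\<mu> (poly_h p) = cinner (poly_h q) (poly_h p0) + cnj (coeff p n) * \<mu> (poly_h w)"
      unfolding p_eq by (simp add: Suc.prems X X_space_cscale q(2)[OF p0])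
    also have "\<dots> = cinner (poly_h (q + smult a w)) (poly_h p)"
      using ww unfolding p_eq
      by (simp add: poly_h_add poly_h_smult cinner_add_left cinner_add_right cinner_cscale_left
          cinner_cscale_right orth orth' p0 a_def)
    finally show "\<mu> (poly_h p) = cinner (poly_h (q + smult a w)) (poly_h p)" .
  qed
qed

lemma continuous_on_cinner: "continuous_on S (cinner g)"
proof -
  \<comment> \<open>Multiplying the first argument by -i rotates the imaginary part into the real
    part, which is the real inner product.\<close>
  have "cinner g f = Complex (inner g f) (inner (cscale (- \<i>) g) f)" for f
    by (simp only: inner_l2_def cinner_cscale_left) (simp add: complex_eq_iff)
  then have "cinner g = (\<lambda>f. of_real (inner g f) + \<i> * of_real (inner (cscale (- \<i>) g) f))"
    by (simp add: fun_eq_iff complex_eq_iff)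
  then show ?thesis
    by (simp only:) (intro continuous_intros)
qed

text \<open>Openness in \<open>X_top\<close> is tested on each \<open>X_sub n\<close>, where the
  functional coincides with an inner product and is therefore continuous.\<close>

lemma continuous_map_antilinear:
  assumes "\<And>f g. f \<in> X_space \<Longrightarrow> g \<in> X_space \<Longrightarrow> \<mu> (f + g) = \<mu> f + \<mu> g"
    and "\<And>c f. f \<in> X_space \<Longrightarrow> \<mu> (cscale c f) = cnj c * \<mu> f"
  shows "continuous_map X_top euclidean \<mu>"
  unfolding continuous_map topspace_X_top openin_X_top
proof (intro conjI allI impI)
  fix U n assume "openin euclidean (U :: complex set)"
  obtain q where q: "\<forall>p. (\<forall>i\<ge>Suc n. coeff p i = 0) \<longrightarrow> \<mu> (poly_h p) = cinner (poly_h q) (poly_h p)"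
    using antilinear_representation[OF assms, of "Suc n"] by blast
  have "\<mu> f = cinner (poly_h q) f" if "f \<in> X_sub n" for f
    using that q by (auto simp: X_sub_def coeff_eq_0)
  then have "{f \<in> X_space. \<mu> f \<in> U} \<inter> X_sub n = X_sub n \<inter> cinner (poly_h q) -` U"
    by (auto simp: X_space_def)
  also have "openin (top_of_set (X_sub n)) \<dots>"
    using \<open>openin euclidean U\<close> by (intro continuous_openin_preimage_gen continuous_on_cinner) auto
  finally show "openin (top_of_set (X_sub n)) ({f \<in> X_space. \<mu> f \<in> U} \<inter> X_sub n)" .
qed auto

text \<open>The dual of X is its full algebraic antidual, so membership becomes an algebraic
  check.\<close>

lemma X_dual_iff:
  "\<mu> \<in> X_dual \<longleftrightarrow>
    (\<forall>f\<in>X_space. \<forall>g\<in>X_space. \<mu> (f + g) = \<mu> f + \<mu> g) \<and>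
    (\<forall>c. \<forall>f\<in>X_space. \<mu> (cscale c f) = cnj c * \<mu> f) \<and> (\<forall>f. f \<notin> X_space \<longrightarrow> \<mu> f = 0)"
  using continuous_map_antilinear[of \<mu>] by (auto simp: X_dual_def)

lemma gelfand_embed_in_X_dual: "gelfand_embed g \<in> X_dual"
  by (auto simp: X_dual_iff gelfand_embed_def cinner_add_right cinner_cscale_right X_space_add
      X_space_cscale)

text \<open>Coordinates in the basis \<open>Phi\<close>, stored as a polynomial so that
  \<open>degree\<close> bounds their support; meaningful on \<open>X_space\<close> only.\<close>

definition Phi_coord :: "l2 \<Rightarrow> complex poly" where
  "Phi_coord = inv Phi_comb"

lemma Phi_coord_Phi_comb [simp]: "Phi_coord (Phi_comb p) = p"
  by (simp add: Phi_coord_def inj_Phi_comb)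

lemma Phi_comb_Phi_coord [simp]: "f \<in> X_space \<Longrightarrow> Phi_comb (Phi_coord f) = f"
  by (simp add: Phi_coord_def f_inv_into_f range_Phi_comb)

lemma Phi_coord_add:
  "f \<in> X_space \<Longrightarrow> g \<in> X_space \<Longrightarrow> Phi_coord (f + g) = Phi_coord f + Phi_coord g"
  by (metis Phi_comb_Phi_coord Phi_comb_add Phi_coord_Phi_comb)

lemma Phi_coord_cscale: "f \<in> X_space \<Longrightarrow> Phi_coord (cscale c f) = smult c (Phi_coord f)"
  by (metis Phi_comb_Phi_coord Phi_comb_smult Phi_coord_Phi_comb)

lemma Phi_coord_Phi: "Phi_coord (Phi n) = monom 1 n"
  by (metis Phi_comb_monom Phi_coord_Phi_comb l2.scale_one)

lemma perron_frobenius_in_X_space: "f \<in> X_space \<Longrightarrow> perron_frobenius f \<in> X_space"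
  using perron_frobenius_Phi_comb[of "Phi_coord f"] by (auto simp flip: range_Phi_comb)

lemma Phi_comb_in_X_space: "Phi_comb p \<in> X_space"
  by (simp flip: range_Phi_comb)

text \<open>Membership of the sum is carried through the induction because additivity of \<mu> is
  available on \<open>X_space\<close> only.\<close>

lemma X_dual_sum:
  assumes "\<mu> \<in> X_dual" "finite A" "\<And>i. i \<in> A \<Longrightarrow> u i \<in> X_space"
  shows "(\<Sum>i\<in>A. u i) \<in> X_space \<and> \<mu> (\<Sum>i\<in>A. u i) = (\<Sum>i\<in>A. \<mu> (u i))"
  using assms(2,3)
proof (induction A rule: finite_induct)
  case empty
  have "0 \<in> X_space"
    by (metis Phi_comb_in_X_space Phi_comb_eq_0_iff)
  moreover from this have "\<mu> (cscale 0 0) = cnj 0 * \<mu> 0"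
    using assms(1) unfolding X_dual_iff by blast
  ultimately show ?case
    by simp
qed (use assms(1) in \<open>auto simp: X_dual_iff X_space_add\<close>)

lemma X_dual_Phi_comb:
  assumes "\<mu> \<in> X_dual"
  shows "\<mu> (Phi_comb p) = (\<Sum>i\<le>degree p. cnj (coeff p i) * \<mu> (Phi i))"
proof -
  have "\<mu> (Phi_comb p) = (\<Sum>i\<le>degree p. \<mu> (cscale (coeff p i) (Phi i)))"
    unfolding Phi_comb_def
    using X_dual_sum[OF assms, of "{..degree p}" "\<lambda>i. cscale (coeff p i) (Phi i)"]
    by (auto simp: Phi_in_X_space X_space_cscale)
  also have "\<dots> = (\<Sum>i\<le>degree p. cnj (coeff p i) * \<mu> (Phi i))"
    using assms by (simp add: X_dual_iff Phi_in_X_space)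
  finally show ?thesis .
qed

lemma X_dual_eqI:
  assumes "\<mu> \<in> X_dual" "\<nu> \<in> X_dual" and eq: "\<And>j. \<mu> (Phi j) = \<nu> (Phi j)"
  shows "\<mu> = \<nu>"
proof
  fix f
  show "\<mu> f = \<nu> f"
  proof (cases "f \<in> X_space")
    case True
    then obtain p where p: "f = Phi_comb p"
      by (metis Phi_comb_Phi_coord)
    show ?thesis
      unfolding p X_dual_Phi_comb[OF assms(1)] X_dual_Phi_comb[OF assms(2)] eq ..
  qed (use assms(1,2) in \<open>auto simp: X_dual_iff\<close>)
qed

text \<open>Conjugation turns the linear coordinate into an antilinear functional; uniqueness holds
  because the \<open>Phi j\<close> span X.\<close>

lemma Phi_dual_eq:
  "Phi_dual i = (\<lambda>f. if f \<in> X_space then cnj (coeff (Phi_coord f) i) else 0)" (is "_ = ?\<nu>")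
  unfolding Phi_dual_def
proof (rule the_equality)
  show \<nu>: "?\<nu> \<in> X_dual \<and> (\<forall>j. ?\<nu> (Phi j) = (if i = j then 1 else 0))"
    by (auto simp: X_dual_iff X_space_add X_space_cscale Phi_coord_add Phi_coord_cscale
        Phi_in_X_space Phi_coord_Phi)
  fix \<mu> assume \<mu>: "\<mu> \<in> X_dual \<and> (\<forall>j. \<mu> (Phi j) = (if i = j then 1 else 0))"
  show "\<mu> = ?\<nu>"
    by (rule X_dual_eqI) (use \<mu> \<nu> in simp_all)
qed

lemma dual_koopman_in_X_dual:
  assumes "\<mu> \<in> X_dual"
  shows "dual_koopman \<mu> \<in> X_dual"
  using assms by (auto simp: X_dual_iff dual_koopman_def X_space_add X_space_cscale
      perron_frobenius_add perron_frobenius_cscale perron_frobenius_in_X_space)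

section \<open>The spectral decompositions\<close>

text \<open>On \<open>X\<close> all but finitely many coordinates vanish, so both series are eventually constant.\<close>

lemma sum_lessThan_eq_atMost_degree:
  assumes "n > degree p" and "\<And>i. coeff p i = 0 \<Longrightarrow> u i = 0"
  shows "(\<Sum>i<n. u i) = (\<Sum>i\<le>degree p. u i)"
  using assms by (intro sum.mono_neutral_right) (auto simp: coeff_eq_0)

lemma perron_frobenius_decomposition:
  assumes "f \<in> X_space"
  shows "limitin X_top (\<lambda>n. \<Sum>i<n. cscale ((1/2) ^ i * cnj (Phi_dual i f)) (Phi i))
    (perron_frobenius f) sequentially"
proof (rule limitin_eventually)
  show "perron_frobenius f \<in> topspace X_top"
    using assms by (simp add: topspace_X_top perron_frobenius_in_X_space)
  let ?p = "Phi_coord f"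
  have "perron_frobenius f = Phi_comb (pcompose ?p [:0, 1/2:])"
    using assms by (metis Phi_comb_Phi_coord perron_frobenius_Phi_comb)
  then have V: "perron_frobenius f = (\<Sum>i\<le>degree ?p. cscale ((1/2) ^ i * coeff ?p i) (Phi i))"
    by (simp add: Phi_comb_def degree_pcompose coeff_pcompose_linear)
  \<comment> \<open>The conjugations in the series and in \<open>Phi_dual\<close> cancel, leaving
    the coordinate itself.\<close>
  have "(\<Sum>i<n. cscale ((1/2) ^ i * cnj (Phi_dual i f)) (Phi i)) = perron_frobenius f"
    if "n > degree ?p" for n
    unfolding V Phi_dual_eq using assms that
    by (subst sum_lessThan_eq_atMost_degree[of ?p]) auto
  then show "\<forall>\<^sub>F n in sequentially.
      (\<Sum>i<n. cscale ((1/2) ^ i * cnj (Phi_dual i f)) (Phi i)) = perron_frobenius f"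
    using eventually_gt_at_top by (rule eventually_mono[rotated])
qed

lemma dual_koopman_decomposition:
  assumes "\<mu> \<in> X_dual"
  shows "limitin weak_star (\<lambda>n f. \<Sum>i<n. (1/2) ^ i * \<mu> (Phi i) * Phi_dual i f)
    (dual_koopman \<mu>) sequentially"
  unfolding weak_star_def limitin_subtopology
proof (intro conjI always_eventually allI)
  show "dual_koopman \<mu> \<in> X_dual"
    using assms by (rule dual_koopman_in_X_dual)
  \<comment> \<open>Convergence in the subspace topology \<open>weak_star\<close> also asks that the
    partial sums lie in \<open>X_dual\<close>.\<close>
  show "(\<lambda>f. \<Sum>i<n. (1/2) ^ i * \<mu> (Phi i) * Phi_dual i f) \<in> X_dual" for n
    by (auto simp: X_dual_iff Phi_dual_eq X_space_add X_space_cscale Phi_coord_add Phi_coord_cscale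
        sum_distrib_left ring_distribs mult_ac simp flip: sum.distrib)
  have "(\<lambda>n. \<Sum>i<n. (1/2) ^ i * \<mu> (Phi i) * Phi_dual i f) \<longlonglongrightarrow> dual_koopman \<mu> f" for f
  proof (cases "f \<in> X_space")
    case True
    let ?p = "Phi_coord f"
    have "perron_frobenius f = Phi_comb (pcompose ?p [:0, 1/2:])"
      using True by (metis Phi_comb_Phi_coord perron_frobenius_Phi_comb)
    then have U: "dual_koopman \<mu> f = (\<Sum>i\<le>degree ?p. (1/2) ^ i * \<mu> (Phi i) * cnj (coeff ?p i))"
      using True X_dual_Phi_comb[OF assms, of "pcompose ?p [:0, 1/2:]"]
      by (simp add: dual_koopman_def degree_pcompose coeff_pcompose_linear mult_ac)
    have "(\<Sum>i<n. (1/2) ^ i * \<mu> (Phi i) * Phi_dual i f) = dual_koopman \<mu> f"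
      if "n > degree ?p" for n
      unfolding U Phi_dual_eq using True that
      by (subst sum_lessThan_eq_atMost_degree[of ?p]) auto
    then have "\<forall>\<^sub>F n in sequentially.
        (\<Sum>i<n. (1/2) ^ i * \<mu> (Phi i) * Phi_dual i f) = dual_koopman \<mu> f"
      using eventually_gt_at_top by (rule eventually_mono[rotated])
    then show ?thesis
      by (rule tendsto_eventually)
  next
    case False
    then show ?thesis
      by (simp add: dual_koopman_def Phi_dual_eq)
  qed
  then show "limitin euclidean (\<lambda>n f. \<Sum>i<n. (1/2) ^ i * \<mu> (Phi i) * Phi_dual i f)
      (dual_koopman \<mu>) sequentially"
    unfolding euclidean_product_topology[symmetric] limitin_componentwise by simp
qed

section \<open>The generalized resolvent\<close>

text \<open>The inverse of l - V in coordinates. At l = 2^-i the division returns 0; such l are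
  excluded from the domain of the continuation.\<close>

definition resolvent_poly :: "complex \<Rightarrow> complex poly \<Rightarrow> complex poly" where
  "resolvent_poly l p = (\<Sum>i\<le>degree p. monom (coeff p i / (l - (1/2) ^ i)) i)"

lemma coeff_resolvent_poly: "coeff (resolvent_poly l p) i = coeff p i / (l - (1/2) ^ i)"
proof -
  have "coeff (resolvent_poly l p) i =
      (\<Sum>j\<le>degree p. if j = i then coeff p j / (l - (1/2) ^ j) else 0)"
    by (simp add: resolvent_poly_def coeff_sum)
  then show ?thesis
    by (simp add: coeff_eq_0)
qed

lemma degree_resolvent_poly: "degree (resolvent_poly l p) \<le> degree p"
  by (rule degree_le) (simp add: coeff_resolvent_poly coeff_eq_0)

lemma cinner_resolvent_poly:
  assumes "degree p \<le> n"
  shows "cinner (Phi_comb (resolvent_poly l p)) g =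
    (\<Sum>i\<le>n. coeff p i * cinner (Phi i) g * (1 / (l - (1/2) ^ i)))"
proof -
  have sum: "cinner (sum u A) g = (\<Sum>i\<in>A. cinner (u i) g)" for u and A :: "nat set"
    by (induction A rule: infinite_finite_induct) (auto simp: cinner_add_left)
  show ?thesis
    using assms degree_resolvent_poly[of l p]
    by (simp add: Phi_comb_eq[of _ n] sum cinner_cscale_left coeff_resolvent_poly)
qed

lemma resolvent_Phi_comb:
  assumes "cmod l > 1"
  shows "resolvent l (Phi_comb p) = Phi_comb (resolvent_poly l p)"
proof -
  have neq: "l \<noteq> (1/2) ^ i" for i
    using assms power_le_one[of "1/2 :: real" i] by (auto simp: norm_power norm_divide)
  have "smult l (resolvent_poly l p) - pcompose (resolvent_poly l p) [:0, 1/2:] = p"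
  proof (rule poly_eqI)
    fix i
    have "l * c - (1/2) ^ i * c = (l - (1/2) ^ i) * c" for c
      by (simp add: algebra_simps)
    then show "coeff (smult l (resolvent_poly l p) - pcompose (resolvent_poly l p) [:0, 1/2:]) i
        = coeff p i"
      using neq[of i] by (simp only: coeff_diff coeff_smult coeff_pcompose_linear coeff_resolvent_poly) simp
  qed
  then have "cscale l (Phi_comb (resolvent_poly l p)) -
      perron_frobenius (Phi_comb (resolvent_poly l p)) = Phi_comb p"
    unfolding perron_frobenius_Phi_comb Phi_comb_smult[symmetric] Phi_comb_diff[symmetric] by simp
  then show ?thesis
    unfolding resolvent_def
    using inv_f_f[OF inj_scale_minus_perron_frobenius[OF assms], of "Phi_comb (resolvent_poly l p)"]
    by simp
qed

text \<open>The point 0 is added as the limit of the eigenvalues, so that the complement is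
  open.\<close>

definition dyadic_spectrum :: "complex set" where
  "dyadic_spectrum = insert 0 (range (\<lambda>k. (1/2) ^ k))"

lemma closed_dyadic_spectrum: "closed dyadic_spectrum"
proof -
  have "(\<lambda>k. (1/2 :: complex) ^ k) \<longlonglongrightarrow> 0"
    by (rule LIMSEQ_power_zero) (simp add: norm_divide)
  from compact_sequence_with_limit[OF this] show ?thesis
    unfolding dyadic_spectrum_def by (rule compact_imp_closed)
qed

text \<open>A countable set does not disconnect the plane.\<close>

lemma connected_Compl_dyadic_spectrum: "connected (- dyadic_spectrum)"
  by (intro path_connected_imp_connected path_connected_complement_countable)
     (auto simp: dyadic_spectrum_def)

lemma norm_le_1_dyadic_spectrum: "l \<in> dyadic_spectrum \<Longrightarrow> cmod l \<le> 1"
  by (auto simp: dyadic_spectrum_def norm_power norm_divide power_le_one)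

lemma half_power_in_dyadic_spectrum: "(1/2) ^ k \<in> dyadic_spectrum"
  by (simp add: dyadic_spectrum_def)

text \<open>The neighbours 2^-(k+1) and 2^-(k-1) of 2^-k lie at distances 2^-(k+1) and 2^-k, so the
  smaller neighbour decides.\<close>

lemma dyadic_spectrum_separated:
  assumes "l \<in> dyadic_spectrum" "l \<noteq> (1/2) ^ k"
  shows "dist ((1/2) ^ k) l \<ge> (1/2) ^ Suc k"
proof -
  obtain x :: real where x: "l = of_real x" "x \<le> (1/2) ^ Suc k \<or> x \<ge> 2 * (1/2) ^ k"
  proof (cases "l = 0")
    case True
    then show ?thesis
      by (intro that[of 0]) auto
  next
    case False
    then obtain j where j: "l = (1/2) ^ j" "j \<noteq> k"
      using assms by (auto simp: dyadic_spectrum_def)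
    show ?thesis
    proof (rule that[of "(1/2) ^ j"])
      show "l = of_real ((1/2) ^ j)"
        by (simp add: j)
      show "(1/2 :: real) ^ j \<le> (1/2) ^ Suc k \<or> (1/2 :: real) ^ j \<ge> 2 * (1/2) ^ k"
      proof (cases "j < k")
        case True
        then have "(1/2 :: real) ^ k \<le> (1/2) ^ Suc j"
          by (intro power_decreasing) auto
        then show ?thesis by simp
      next
        case False
        then show ?thesis
          using j(2) by (intro disjI1 power_decreasing) auto
      qed
    qed
  qed
  have "dist ((1/2) ^ k) l = cmod (of_real ((1/2) ^ k - x))"
    by (simp add: x(1) dist_norm)
  also have "\<dots> = \<bar>(1/2) ^ k - x\<bar>"
    by (rule norm_of_real)
  also have "\<dots> \<ge> (1/2) ^ Suc k"
    using x(2) zero_le_power[of "1/2 :: real" k] by (auto simp: abs_if)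
  finally show ?thesis .
qed

definition dyadic_resolvent :: "complex \<Rightarrow> l2 \<Rightarrow> l2 \<Rightarrow> complex" where
  "dyadic_resolvent l f = gelfand_embed (Phi_comb (resolvent_poly l (Phi_coord f)))"

lemma resolvent_continuation_dyadic:
  "resolvent_continuation (- dyadic_spectrum) dyadic_resolvent"
  unfolding resolvent_continuation_def
proof (intro conjI ballI allI impI)
  show "open (- dyadic_spectrum)"
    using closed_dyadic_spectrum by (simp add: open_Compl)
  show "connected (- dyadic_spectrum)"
    by (rule connected_Compl_dyadic_spectrum)
  show "{l. cmod l > 1} \<subseteq> - dyadic_spectrum"
    using norm_le_1_dyadic_spectrum by force
  \<comment> \<open>A negative number witnesses that the domain enters the unit disc, since the
    singularities are nonnegative reals.\<close>
  have "- 1/2 \<notin> dyadic_spectrum"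
  proof
    assume "- 1/2 \<in> dyadic_spectrum"
    then obtain k where "(- 1/2 :: complex) = of_real ((1/2) ^ k)"
      by (auto simp: dyadic_spectrum_def)
    then have "Re (- 1/2) = (1/2) ^ k"
      by (metis Re_complex_of_real)
    moreover have "(1/2 :: real) ^ k > 0"
      by simp
    ultimately show False
      by simp
  qed
  moreover have "(- 1/2 :: complex) \<in> ball 0 1"
    by simp
  ultimately show "- dyadic_spectrum \<inter> ball 0 1 \<noteq> {}"
    by blast
  show "dyadic_resolvent l f \<in> X_dual" for l f
    by (simp add: dyadic_resolvent_def gelfand_embed_in_X_dual)
  fix f assume f: "f \<in> X_space"
  show "dyadic_resolvent l (f + g) k = dyadic_resolvent l f k + dyadic_resolvent l g k"
    if "g \<in> X_space" for l g k
  proof -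
    have "resolvent_poly l (Phi_coord (f + g)) =
        resolvent_poly l (Phi_coord f) + resolvent_poly l (Phi_coord g)"
      using f that
      by (intro poly_eqI) (simp add: coeff_resolvent_poly Phi_coord_add add_divide_distrib)
    then show ?thesis
      by (simp add: dyadic_resolvent_def gelfand_embed_def Phi_comb_add cinner_add_left)
  qed
  show "dyadic_resolvent l (cscale c f) k = c * dyadic_resolvent l f k" for l c k
  proof -
    have "resolvent_poly l (Phi_coord (cscale c f)) = smult c (resolvent_poly l (Phi_coord f))"
      using f by (intro poly_eqI) (simp add: coeff_resolvent_poly Phi_coord_cscale)
    then show ?thesis
      by (simp add: dyadic_resolvent_def gelfand_embed_def Phi_comb_smult cinner_cscale_left)
  qed
  show "(\<lambda>l. dyadic_resolvent l f g) holomorphic_on - dyadic_spectrum" if "g \<in> X_space" for g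
    unfolding dyadic_resolvent_def gelfand_embed_def
    using that by (auto simp: cinner_resolvent_poly[OF order_refl] dyadic_spectrum_def
        intro!: holomorphic_intros)
next
  fix l f assume "cmod l > 1 \<and> f \<in> X_space"
  then show "dyadic_resolvent l f = gelfand_embed (resolvent l f)"
    using resolvent_Phi_comb[of l "Phi_coord f"] by (simp add: dyadic_resolvent_def)
qed

text \<open>The function \<open>(\<lambda> - 2\<^sup>-\<^sup>k) \<langle>R\<^sub>\<lambda> \<Phi>\<^sub>k | \<Phi>\<^sub>k\<rangle>\<close> has the nonzero constant value \<open>(\<Phi>\<^sub>k, \<Phi>\<^sub>k)\<close> for
  \<open>|\<lambda>| > 1\<close>, hence on the domain of any continuation, which therefore omits \<open>2\<^sup>-\<^sup>k\<close>; being open, it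
  also omits the limit point 0.\<close>

lemma resolvent_continuation_domain:
  assumes "resolvent_continuation \<Omega> R"
  shows "\<Omega> \<subseteq> - dyadic_spectrum"
proof -
  have opn: "open \<Omega>" and conn: "connected \<Omega>" and sub: "{l. cmod l > 1} \<subseteq> \<Omega>"
    and hol: "\<And>f g. f \<in> X_space \<Longrightarrow> g \<in> X_space \<Longrightarrow> (\<lambda>l. R l f g) holomorphic_on \<Omega>"
    and res: "\<And>l f. cmod l > 1 \<Longrightarrow> f \<in> X_space \<Longrightarrow> R l f = gelfand_embed (resolvent l f)"
    using assms by (auto simp: resolvent_continuation_def)
  have power: "(1/2) ^ k \<notin> \<Omega>" for k
  proof
    assume k: "(1/2) ^ k \<in> \<Omega>"
    have val: "(l - (1/2) ^ k) * R l (Phi k) (Phi k) = cinner (Phi k) (Phi k)" if l: "cmod l > 1" for l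
    proof -
      have "l \<noteq> (1/2) ^ k"
        using l norm_le_1_dyadic_spectrum[OF half_power_in_dyadic_spectrum[of k]] by auto
      moreover have "Phi_comb (monom 1 k) = Phi k"
        by (simp add: Phi_comb_monom)
      then have "R l (Phi k) (Phi k) = cinner (Phi_comb (resolvent_poly l (monom 1 k))) (Phi k)"
        using res[OF l Phi_in_X_space[of k]] resolvent_Phi_comb[OF l, of "monom 1 k"]
        by (simp add: gelfand_embed_def Phi_in_X_space)
      moreover have "resolvent_poly l (monom 1 k) = monom (1 / (l - (1/2) ^ k)) k"
        by (rule poly_eqI) (simp add: coeff_resolvent_poly)
      ultimately show ?thesis
        by (simp add: Phi_comb_monom cinner_cscale_left)
    qed
    \<comment> \<open>At l = 2^-k the left factor is 0, while the right side is the squared norm of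
      \<open>Phi k\<close>.\<close>
    have "((1/2) ^ k - (1/2) ^ k) * R ((1/2) ^ k) (Phi k) (Phi k) = cinner (Phi k) (Phi k)"
    proof (rule analytic_continuation_open[where s="{l. cmod l > 1}" and s'=\<Omega>
          and f="\<lambda>l. (l - (1/2) ^ k) * R l (Phi k) (Phi k)" and g="\<lambda>_. cinner (Phi k) (Phi k)"])
      show "open {l. cmod l > 1}"
        by (intro open_Collect_less continuous_intros)
      show "{l. cmod l > 1} \<noteq> {}"
        by (auto intro!: exI[of _ 2])
      show "(\<lambda>l. (l - (1/2) ^ k) * R l (Phi k) (Phi k)) holomorphic_on \<Omega>"
        by (intro holomorphic_intros hol Phi_in_X_space)
    qed (use opn conn sub val k in auto)
    then show False
      by (simp add: Phi_neq_0)
  qed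
  have "0 \<notin> \<Omega>"
  proof
    assume "0 \<in> \<Omega>"
    moreover have "(\<lambda>k. (1/2 :: complex) ^ k) \<longlonglongrightarrow> 0"
      by (rule LIMSEQ_power_zero) (simp add: norm_divide)
    ultimately have "\<forall>\<^sub>F k in sequentially. (1/2) ^ k \<in> \<Omega>"
      using opn topological_tendstoD by blast
    with power show False
      by simp
  qed
  with power show ?thesis
    by (auto simp: dyadic_spectrum_def)
qed

lemma generalized_resolvent_dyadic:
  "generalized_resolvent (- dyadic_spectrum) dyadic_resolvent"
  unfolding generalized_resolvent_def
  using resolvent_continuation_dyadic resolvent_continuation_domain by blast

text \<open>Maximality only forbids proper extensions; comparison with the largest domain turns it
  into equality.\<close>

lemma generalized_resolvent_domain:
  "generalized_resolvent \<Omega> R \<Longrightarrow> \<Omega> = - dyadic_spectrum"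
  unfolding generalized_resolvent_def
  using resolvent_continuation_dyadic resolvent_continuation_domain by blast

text \<open>Both continuations agree for |l| > 1 and the domain is connected, so the identity
  theorem applies to each pairing with g in X; off X both functionals vanish.\<close>

lemma generalized_resolvent_unique:
  assumes "generalized_resolvent \<Omega> R" "l \<in> \<Omega>" "f \<in> X_space"
  shows "R l f = dyadic_resolvent l f"
proof
  fix g
  have R: "resolvent_continuation \<Omega> R" and D: "resolvent_continuation \<Omega> dyadic_resolvent"
    using assms(1) resolvent_continuation_dyadic generalized_resolvent_domain[OF assms(1)]
    by (auto simp: generalized_resolvent_def)
  show "R l f g = dyadic_resolvent l f g"
  proof (cases "g \<in> X_space")
    case True
    show ?thesis
    proof (rule analytic_continuation_open[where s="{l. cmod l > 1}" and s'=\<Omega>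
          and f="\<lambda>l. R l f g" and g="\<lambda>l. dyadic_resolvent l f g"])
      show "open {l. cmod l > 1}"
        by (intro open_Collect_less continuous_intros)
      show "{l. cmod l > 1} \<noteq> {}"
        by (auto intro!: exI[of _ 2])
    qed (use R D True assms(2,3) in \<open>auto simp: resolvent_continuation_def\<close>)
  next
    case False
    have "R l f \<in> X_dual" "dyadic_resolvent l f \<in> X_dual"
      using R D assms(2,3) by (auto simp: resolvent_continuation_def)
    with False show ?thesis
      by (simp add: X_dual_iff)
  qed
qed

section \<open>The Riesz projections\<close>

text \<open>0 is an accumulation point of the other singularities; around 2^-k the separation bound
  supplies the radius.\<close>

lemma isolated_singularity_iff:
  "isolated_singularity (- dyadic_spectrum) l \<longleftrightarrow> (\<exists>k. l = (1/2) ^ k)"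
proof
  assume "isolated_singularity (- dyadic_spectrum) l"
  then obtain r where r: "r > 0" "dyadic_spectrum \<inter> ball l r = {l}" and l: "l \<in> dyadic_spectrum"
    by (auto simp: isolated_singularity_def generalized_spectrum_def)
  have "l \<noteq> 0"
  proof
    assume "l = 0"
    obtain k where "(1/2 :: real) ^ k < r"
      using real_arch_pow_inv[OF r(1), of "1/2"] by auto
    then have "(1/2) ^ k \<in> dyadic_spectrum \<inter> ball l r"
      by (simp add: \<open>l = 0\<close> half_power_in_dyadic_spectrum norm_power norm_divide)
    then have "(1/2) ^ k = l"
      unfolding r(2) by (rule singletonD)
    then show False
      by (simp add: \<open>l = 0\<close>)
  qed
  with l show "\<exists>k. l = (1/2) ^ k"
    by (auto simp: dyadic_spectrum_def)
next
  assume "\<exists>k. l = (1/2) ^ k"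
  then obtain k where k: "l = (1/2) ^ k" ..
  have "dyadic_spectrum \<inter> ball l ((1/2) ^ Suc k) = {l}"
  proof (intro equalityI subsetI)
    fix x assume "x \<in> dyadic_spectrum \<inter> ball l ((1/2) ^ Suc k)"
    then have "x \<in> dyadic_spectrum" "\<not> dist l x \<ge> (1/2) ^ Suc k"
      by (auto simp only: Int_iff mem_ball not_le)
    then show "x \<in> {l}"
      using dyadic_spectrum_separated[of x k] unfolding k by blast
  qed (use half_power_in_dyadic_spectrum[of k] in \<open>auto simp: k\<close>)
  moreover have "(1/2 :: real) ^ Suc k > 0"
    by simp
  moreover have "l \<in> dyadic_spectrum"
    unfolding k by (rule half_power_in_dyadic_spectrum)
  ultimately show "isolated_singularity (- dyadic_spectrum) l"
    unfolding isolated_singularity_def generalized_spectrum_def double_complement by blast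
qed

text \<open>Gives the \<open>SOME\<close> in \<open>riesz_projection\<close> a witness. The radius
  is half the separation distance, so all other singularities lie outside the closed disc.\<close>

lemma encircles_only_exists:
  "encircles_only (- dyadic_spectrum) (circlepath ((1/2) ^ k) ((1/2) ^ Suc (Suc k))) ((1/2) ^ k)"
proof -
  define r :: real where "r = (1/2) ^ Suc (Suc k)"
  have r: "0 < r" "r < (1/2) ^ Suc k"
    by (auto simp: r_def)
  have sep: "l \<notin> cball ((1/2) ^ k) r" if "l \<in> dyadic_spectrum - {(1/2) ^ k}" for l
    using dyadic_spectrum_separated[of l k] that r(2) by auto
  have "winding_number (circlepath ((1/2) ^ k) r) l = 0"
    if "l \<in> dyadic_spectrum - {(1/2) ^ k}" for l
    using sep[OF that] r(1)
    by (intro winding_number_zero_outside[where s="cball ((1/2) ^ k) r"]) (auto simp: sphere_cball)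
  moreover have "l \<notin> sphere ((1/2) ^ k) r" if "l \<in> dyadic_spectrum" for l
    using sep[of l] that r(1) by (cases "l = (1/2) ^ k") auto
  ultimately show ?thesis
    unfolding encircles_only_def r_def[symmetric] generalized_spectrum_def
    using r(1) by (auto simp: simple_path_circlepath winding_number_circlepath_centre)
qed

text \<open>The integrand is a finite sum of simple fractions, so the curve enters through its
  winding numbers only and the value is the same for every admissible choice.\<close>

lemma contour_integral_dyadic_resolvent:
  assumes "encircles_only (- dyadic_spectrum) \<gamma> ((1/2) ^ k)" "f \<in> X_space" "g \<in> X_space"
  shows "contour_integral \<gamma> (\<lambda>z. dyadic_resolvent z f g) =
    2 * of_real pi * \<i> * (coeff (Phi_coord f) k * cinner (Phi k) g)"
proof -
  let ?p = "Phi_coord f"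
  \<comment> \<open>The sum must contain the index \<open>k\<close> even when it exceeds the
    degree.\<close>
  let ?n = "max k (degree ?p)"
  have \<gamma>: "valid_path \<gamma>" "path_image \<gamma> \<subseteq> - dyadic_spectrum" "winding_number \<gamma> ((1/2) ^ k) = 1"
    "\<And>l. l \<in> dyadic_spectrum - {(1/2) ^ k} \<Longrightarrow> winding_number \<gamma> l = 0"
    using assms(1) by (auto simp: encircles_only_def generalized_spectrum_def)
  have wn: "winding_number \<gamma> ((1/2) ^ i) = (if i = k then 1 else 0)" for i
    using \<gamma>(3) \<gamma>(4)[of "(1/2) ^ i"] by (auto simp: half_power_in_dyadic_spectrum half_power_eq_iff)
  have "((\<lambda>z. \<Sum>i\<le>?n. coeff ?p i * cinner (Phi i) g * (1 / (z - (1/2) ^ i)))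
      has_contour_integral (\<Sum>i\<le>?n. coeff ?p i * cinner (Phi i) g *
        (2 * pi * \<i> * winding_number \<gamma> ((1/2) ^ i)))) \<gamma>"
    using \<gamma>(1,2) half_power_in_dyadic_spectrum
    by (intro has_contour_integral_sum has_contour_integral_lmul has_contour_integral_winding_number)
       auto
  moreover have "dyadic_resolvent z f g =
      (\<Sum>i\<le>?n. coeff ?p i * cinner (Phi i) g * (1 / (z - (1/2) ^ i)))" for z
    using assms(3) cinner_resolvent_poly[of ?p ?n z g]
    by (simp add: dyadic_resolvent_def gelfand_embed_def)
  moreover have "(\<Sum>i\<le>?n. coeff ?p i * cinner (Phi i) g *
      (2 * pi * \<i> * winding_number \<gamma> ((1/2) ^ i))) =
      (\<Sum>i\<le>?n. if i = k then coeff ?p i * cinner (Phi i) g * (2 * pi * \<i>) else 0)"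
    by (intro sum.cong) (auto simp: wn)
  ultimately show ?thesis
    by (simp add: contour_integral_unique)
qed

lemma riesz_projection_eq:
  assumes "generalized_resolvent \<Omega> R" "f \<in> X_space"
  shows "riesz_projection \<Omega> R ((1/2) ^ k) f =
    gelfand_embed (cscale (coeff (Phi_coord f) k) (Phi k))"
proof
  fix g
  define \<gamma> where "\<gamma> = (SOME \<gamma>. encircles_only \<Omega> \<gamma> ((1/2) ^ k))"
  have \<Omega>: "\<Omega> = - dyadic_spectrum"
    using assms(1) by (rule generalized_resolvent_domain)
  have \<gamma>: "encircles_only (- dyadic_spectrum) \<gamma> ((1/2) ^ k)"
    unfolding \<gamma>_def \<Omega>
    using someI_ex[of "\<lambda>\<gamma>. encircles_only (- dyadic_spectrum) \<gamma> ((1/2) ^ k)"]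
      encircles_only_exists by blast
  then have "path_image \<gamma> \<subseteq> \<Omega>"
    by (simp add: encircles_only_def \<Omega>)
  then have "contour_integral \<gamma> (\<lambda>z. R z f g) = contour_integral \<gamma> (\<lambda>z. dyadic_resolvent z f g)"
    using generalized_resolvent_unique[OF assms(1) _ assms(2)]
    by (intro contour_integral_eq) auto
  also have "\<dots> = 2 * of_real pi * \<i> * gelfand_embed (cscale (coeff (Phi_coord f) k) (Phi k)) g"
  proof (cases "g \<in> X_space")
    case True
    then show ?thesis
      using contour_integral_dyadic_resolvent[OF \<gamma> assms(2)]
      by (simp add: gelfand_embed_def cinner_cscale_left)
  next
    case False
    then show ?thesis
      by (simp add: gelfand_embed_def dyadic_resolvent_def)
  qed
  finally show "riesz_projection \<Omega> R ((1/2) ^ k) f g =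
      gelfand_embed (cscale (coeff (Phi_coord f) k) (Phi k)) g"
    unfolding riesz_projection_def \<gamma>_def[symmetric] by simp
qed

lemma gelfand_embed_Phi_eq_0_iff: "gelfand_embed (cscale c (Phi k)) = (\<lambda>_. 0) \<longleftrightarrow> c = 0"
proof
  assume "gelfand_embed (cscale c (Phi k)) = (\<lambda>_. 0)"
  then have "gelfand_embed (cscale c (Phi k)) (Phi k) = 0"
    by (rule fun_cong)
  then show "c = 0"
    by (simp add: gelfand_embed_def Phi_in_X_space cinner_cscale_left Phi_neq_0)
qed (auto simp: gelfand_embed_def)

text \<open>The k-th coordinate maps X onto the complex numbers, so the projection has a whole line
  as image; discarding the zero functional removes exactly c = 0.\<close>

lemma generalized_eigenvectors_eq:
  assumes "generalized_resolvent \<Omega> R"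
  shows "generalized_eigenvectors \<Omega> R ((1/2) ^ k) =
    {gelfand_embed (cscale c (Phi k)) | c. c \<noteq> 0}"
proof -
  have "\<exists>f\<in>X_space. coeff (Phi_coord f) k = c" for c
    by (intro bexI[of _ "cscale c (Phi k)"])
       (simp_all add: X_space_cscale Phi_in_X_space Phi_coord_cscale Phi_coord_Phi)
  then have "(\<lambda>f. coeff (Phi_coord f) k) ` X_space = UNIV"
    by (simp add: set_eq_iff image_iff) metis
  moreover have "generalized_eigenspace \<Omega> R ((1/2) ^ k) =
      (\<lambda>c. gelfand_embed (cscale c (Phi k))) ` (\<lambda>f. coeff (Phi_coord f) k) ` X_space"
    unfolding generalized_eigenspace_def image_image
    by (rule image_cong) (simp_all add: riesz_projection_eq[OF assms])
  ultimately have "generalized_eigenspace \<Omega> R ((1/2) ^ k) =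
      range (\<lambda>c. gelfand_embed (cscale c (Phi k)))"
    by simp
  then show ?thesis
    by (auto simp: generalized_eigenvectors_def gelfand_embed_Phi_eq_0_iff simp del: l2.scale_eq_0_iff)
qed

lemma generalized_eigenvalues_eq:
  assumes "generalized_resolvent \<Omega> R"
  shows "{l. generalized_eigenvalue \<Omega> R l} = {(1/2) ^ k | k :: nat. True}"
proof -
  have "generalized_eigenvectors \<Omega> R ((1/2) ^ k) \<noteq> {}" for k
    unfolding generalized_eigenvectors_eq[OF assms] using zero_neq_one by blast
  then show ?thesis
    using isolated_singularity_iff
    by (auto simp: generalized_eigenvalue_def generalized_resolvent_domain[OF assms])
qed

theorem theorem3p6:
  shows "(\<exists>\<Omega> R. generalized_resolvent \<Omega> R) \<and>
    (\<forall>\<Omega> R. generalized_resolvent \<Omega> R \<longrightarrow>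
       {l. generalized_eigenvalue \<Omega> R l} = {(1/2) ^ k | k :: nat. True} \<and>
       (\<forall>k. generalized_eigenvectors \<Omega> R ((1/2) ^ k) =
          {gelfand_embed (cscale c (Phi k)) | c. c \<noteq> 0})) \<and>
    (\<forall>f\<in>X_space. limitin X_top
       (\<lambda>n. \<Sum>i<n. cscale ((1/2) ^ i * cnj (Phi_dual i f)) (Phi i))
       (perron_frobenius f) sequentially) \<and>
    (\<forall>\<mu>\<in>X_dual. limitin weak_star
       (\<lambda>n f. \<Sum>i<n. (1/2) ^ i * \<mu> (Phi i) * Phi_dual i f)
       (dual_koopman \<mu>) sequentially)"
  using generalized_resolvent_dyadic generalized_eigenvalues_eq generalized_eigenvectors_eq
    perron_frobenius_decomposition dual_koopman_decomposition
  by blast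

end
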